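(* Let $n\geq1$ and $v,w\in\mathfrak{S}_n$, and put $\mathsf{S}=\mathrm{GDes}(v)$. Let $\kappa(v,w)$ be the number of $\zeta\in\mathfrak{S}^{\mathsf{S}}$ satisfying: (i) $v_\mathsf{S}\zeta^{-1}\leq w$; (ii) if $v'\in\mathfrak{S}_n$ with $v\leq v'$ and $v'_\mathsf{S}\zeta^{-1}\leq w$, then $v'=v$; and (iii) if $\mathsf{R}$ satisfies $\mathrm{Des}(\zeta)\subseteq\mathsf{R}\subseteq\mathsf{S}$ and $v_\mathsf{R}\zeta^{-1}\leq w$, then $\mathsf{R}=\mathsf{S}$. Then the antipode $S$ of $\mathfrak{S}\mathit{Sym}$ satisfies \[S(\mathcal{M}_v)=(-1)^{\#\mathrm{GDes}(v)+1}\sum_{w\in\mathfrak{S}_n}\kappa(v,w)\,\mathcal{M}_w.\]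
   Context: $\mathfrak{S}_n$ is the symmetric group on $[n]$ ($\mathfrak{S}_0$ has one element); $u$ is written as the word $u_1\cdots u_n$, $u_i=u(i)$; permutations multiply as functions, $(uv)(i)=u(v(i))$. $\ell(u)=\#\{i<j\mid u_i>u_j\}$; the weak order on $\mathfrak{S}_n$: $u\leq v$ iff $v=wu$ for some $w$ with $\ell(v)=\ell(w)+\ell(u)$. $\mathrm{Des}(u)=\{p\in[n-1]\mid u_p>u_{p+1}\}$; a global descent of $u$ is $p\in[n-1]$ with $u_i>u_j$ whenever $i\leq p<j$, and $\mathrm{GDes}(u)$ is the set of global descents. For $\mathsf{S}\subseteq[n-1]$, $\mathfrak{S}^{\mathsf{S}}=\{\zeta\in\mathfrak{S}_n\mid\mathrm{Des}(\zeta)\subseteq\mathsf{S}\}$. For distinct integers $a_1,\dots,a_p$, $\mathrm{st}(a_1,\dots,a_p)\in\mathfrak{S}_p$ is the permutation $u$ with $u_i<u_j\iff a_i<a_j$. For $u\in\mathfrak{S}_p,v\in\mathfrak{S}_q$, $u\times v\in\mathfrak{S}_{p+q}$ has word $u_1\cdots u_p(v_1+p)\cdots(v_q+p)$. For $\mathsf{S}=\{p_1<\dots<p_k\}\subseteq[n-1]$, $v_\mathsf{S}=\mathrm{st}(v_1,\dots,v_{p_1})\times\mathrm{st}(v_{p_1+1},\dots,v_{p_2})\times\cdots\times\mathrm{st}(v_{p_k+1},\dots,v_n)$. $\mathfrak{S}^{(p,q)}$ is the set of $\zeta\in\mathfrak{S}_{p+q}$ with no descent except possibly at $p$. $\mathfrak{S}\mathit{Sym}$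 is the graded $\mathbb{Q}$-vector space with basis $\{\mathcal{F}_u\mid u\in\mathfrak{S}_n,n\geq0\}$, product $\mathcal{F}_u\cdot\mathcal{F}_v=\sum_{\zeta\in\mathfrak{S}^{(p,q)}}\mathcal{F}_{(u\times v)\zeta^{-1}}$ ($u\in\mathfrak{S}_p,v\in\mathfrak{S}_q$), coproduct $\Delta(\mathcal{F}_u)=\sum_{p=0}^n\mathcal{F}_{\mathrm{st}(u_1,\dots,u_p)}\otimes\mathcal{F}_{\mathrm{st}(u_{p+1},\dots,u_n)}$; it is a graded connected Hopf algebra (Malvenuto–Reutenauer), $S$ its antipode. The monomial basis is $\mathcal{M}_u=\sum_{v\geq u}\mu_{\mathfrak{S}_n}(u,v)\mathcal{F}_v$, $\mu_{\mathfrak{S}_n}$ the Möbius function of the weak order. *)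

theory Defs
  imports Complex_Main "HOL-Combinatorics.Permutations" "HOL-Library.Poly_Mapping"
begin

section \<open>Permutations of \<open>[n]\<close>\<close>

text \<open>
  The symmetric group on \<open>[n]\<close> is the set of all functions \<open>u :: nat \<Rightarrow> nat\<close> with
  \<open>u permutes {1..n}\<close>; these are the identity outside \<open>{1..n}\<close>. The product is function
  composition and the inverse is \<open>inv\<close>. As a function does not determine \<open>n\<close>, the size is
  always passed explicitly.
\<close>

abbreviation Sym :: "nat \<Rightarrow> (nat \<Rightarrow> nat) set" where
  "Sym n \<equiv> {u. u permutes {1..n}}"

definition len :: "nat \<Rightarrow> (nat \<Rightarrow> nat) \<Rightarrow> nat" where
  "len n u = card {(i, j). i \<in> {1..n} \<and> j \<in> {1..n} \<and> i < j \<and> u i > u j}"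

definition weak_le :: "nat \<Rightarrow> (nat \<Rightarrow> nat) \<Rightarrow> (nat \<Rightarrow> nat) \<Rightarrow> bool" where
  "weak_le n u v \<longleftrightarrow> u \<in> Sym n \<and> v \<in> Sym n \<and>
     (\<exists>w \<in> Sym n. v = w \<circ> u \<and> len n v = len n w + len n u)"

definition Des :: "nat \<Rightarrow> (nat \<Rightarrow> nat) \<Rightarrow> nat set" where
  "Des n u = {p \<in> {1..<n}. u p > u (p + 1)}"

definition GDes :: "nat \<Rightarrow> (nat \<Rightarrow> nat) \<Rightarrow> nat set" where
  "GDes n u = {p \<in> {1..<n}. \<forall>i \<in> {1..p}. \<forall>j \<in> {p+1..n}. u i > u j}"

definition Sym_Des :: "nat \<Rightarrow> nat set \<Rightarrow> (nat \<Rightarrow> nat) set" where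
  "Sym_Des n S = {\<zeta> \<in> Sym n. Des n \<zeta> \<subseteq> S}"

lemma strict_mono_permutes_id:
  fixes w :: "nat \<Rightarrow> nat"
  assumes w: "w permutes {1..n}"
    and mono: "\<And>i j. i \<in> {1..n} \<Longrightarrow> j \<in> {1..n} \<Longrightarrow> i < j \<Longrightarrow> w i < w j"
  shows "w = id"
proof -
  have ge: "i \<in> {1..n} \<longrightarrow> i \<le> w i" for i
  proof (induction i)
    case 0
    then show ?case by simp
  next
    case (Suc i)
    show ?case
    proof
      assume prem: "Suc i \<in> {1..n}"
      show "Suc i \<le> w (Suc i)"
      proof (cases "i = 0")
        case True
        have "w (Suc i) \<in> {1..n}" using prem w permutes_in_image by metis
        with True show ?thesis by simp
      next
        case False
        then have i: "i \<in> {1..n}" using prem by simp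
        have "w i < w (Suc i)" using mono[OF i prem] by simp
        with Suc.IH i show ?thesis by simp
      qed
    qed
  qed
  then show ?thesis using permutes_natset_ge[OF w] by blast
qed

text \<open>Standardization of the word \<open>a 1, \<dots>, a p\<close>, for \<open>a\<close> injective on \<open>{1..p}\<close>.\<close>

definition st :: "nat \<Rightarrow> (nat \<Rightarrow> nat) \<Rightarrow> nat \<Rightarrow> nat" where
  "st p a = (THE u. u \<in> Sym p \<and>
     (\<forall>i \<in> {1..p}. \<forall>j \<in> {1..p}. u i < u j \<longleftrightarrow> a i < a j))"

lemma st_unique_existence:
  fixes a :: "nat \<Rightarrow> nat"
  assumes a: "inj_on a {1..p}"
  shows "\<exists>!u. u \<in> Sym p \<and> (\<forall>i \<in> {1..p}. \<forall>j \<in> {1..p}. u i < u j \<longleftrightarrow> a i < a j)"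
proof (rule ex_ex1I)
  define r where "r i = (if i \<in> {1..p} then card {k \<in> {1..p}. a k \<le> a i} else i)" for i
  have less: "r i < r j" if "i \<in> {1..p}" "j \<in> {1..p}" "a i < a j" for i j
  proof -
    have "{k \<in> {1..p}. a k \<le> a i} \<subset> {k \<in> {1..p}. a k \<le> a j}"
    proof
      show "{k \<in> {1..p}. a k \<le> a i} \<subseteq> {k \<in> {1..p}. a k \<le> a j}"
        using that by auto
      have "j \<notin> {k \<in> {1..p}. a k \<le> a i}" "j \<in> {k \<in> {1..p}. a k \<le> a j}"
        using that by auto
      then show "{k \<in> {1..p}. a k \<le> a i} \<noteq> {k \<in> {1..p}. a k \<le> a j}"
        by metis
    qed
    then have "card {k \<in> {1..p}. a k \<le> a i} < card {k \<in> {1..p}. a k \<le> a j}"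
      by (intro psubset_card_mono) auto
    then show ?thesis using that by (simp add: r_def)
  qed
  have iff: "r i < r j \<longleftrightarrow> a i < a j" if "i \<in> {1..p}" "j \<in> {1..p}" for i j
  proof -
    have "a i = a j \<Longrightarrow> r i = r j" using that by (simp add: r_def)
    then show ?thesis
      using less[OF that] less[OF that(2) that(1)] by (metis less_asym less_irrefl linorder_neqE_nat)
  qed
  have inj: "inj_on r {1..p}"
    using iff a unfolding inj_on_def by (metis less_irrefl linorder_neqE_nat)
  have "r ` {1..p} \<subseteq> {1..p}"
  proof
    fix y assume "y \<in> r ` {1..p}"
    then obtain i where i: "i \<in> {1..p}" "y = card {k \<in> {1..p}. a k \<le> a i}"
      by (auto simp: r_def)
    have "y \<le> card {1..p}" unfolding i(2) by (intro card_mono) auto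
    moreover have "y > 0" unfolding i(2) using i(1) by (auto simp: card_gt_0_iff)
    ultimately show "y \<in> {1..p}" by simp
  qed
  with inj have "bij_betw r {1..p} {1..p}"
    by (simp add: bij_betw_def endo_inj_surj)
  then have "r permutes {1..p}"
    by (rule bij_imp_permutes) (auto simp: r_def)
  with iff show "\<exists>u. u \<in> Sym p \<and> (\<forall>i \<in> {1..p}. \<forall>j \<in> {1..p}. u i < u j \<longleftrightarrow> a i < a j)"
    by blast
next
  fix u v
  assume "u \<in> Sym p \<and> (\<forall>i \<in> {1..p}. \<forall>j \<in> {1..p}. u i < u j \<longleftrightarrow> a i < a j)"
    and "v \<in> Sym p \<and> (\<forall>i \<in> {1..p}. \<forall>j \<in> {1..p}. v i < v j \<longleftrightarrow> a i < a j)"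
  then have u: "u permutes {1..p}" and v: "v permutes {1..p}"
    and uv: "\<And>i j. i \<in> {1..p} \<Longrightarrow> j \<in> {1..p} \<Longrightarrow> u i < u j \<longleftrightarrow> v i < v j"
    by blast+
  have "u \<circ> inv v = id"
  proof (rule strict_mono_permutes_id)
    show "u \<circ> inv v permutes {1..p}" using u v by (intro permutes_compose permutes_inv)
    fix i j assume ij: "i \<in> {1..p}" "j \<in> {1..p}" "i < j"
    then have "inv v i \<in> {1..p}" "inv v j \<in> {1..p}"
      using permutes_in_image[OF permutes_inv[OF v]] by blast+
    with uv[of "inv v i" "inv v j"] ij show "(u \<circ> inv v) i < (u \<circ> inv v) j"
      by (simp add: permutes_inverses[OF v])
  qed
  then show "u = v" using permutes_inverses(2)[OF v] by (metis comp_apply id_apply ext)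
qed

text \<open>
  The permutation \<open>u \<times> v\<close> of \<open>[p + q]\<close> for \<open>u \<in> Sym p\<close> and \<open>v \<in> Sym q\<close>. The size \<open>q\<close> is not
  needed, as \<open>v\<close> is the identity beyond \<open>q\<close>.
\<close>

definition cross :: "nat \<Rightarrow> (nat \<Rightarrow> nat) \<Rightarrow> (nat \<Rightarrow> nat) \<Rightarrow> nat \<Rightarrow> nat" where
  "cross p u v = (\<lambda>i. if i \<le> p then u i else v (i - p) + p)"

text \<open>
  \<open>st_blocks n a [p\<^sub>1, \<dots>, p\<^sub>k] v\<close>, for \<open>a < p\<^sub>1 < \<dots> < p\<^sub>k < n\<close>, is
  \<open>st(v\<^bsub>a+1\<^esub>, \<dots>, v\<^bsub>p\<^sub>1\<^esub>) \<times> \<dots> \<times> st(v\<^bsub>p\<^sub>k+1\<^esub>, \<dots>, v\<^bsub>n\<^esub>)\<close>, so \<open>par n S v\<close> is \<open>v\<^sub>S\<close>.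
\<close>

fun st_blocks :: "nat \<Rightarrow> nat \<Rightarrow> nat list \<Rightarrow> (nat \<Rightarrow> nat) \<Rightarrow> nat \<Rightarrow> nat" where
  "st_blocks n a [] v = st (n - a) (\<lambda>i. v (a + i))"
| "st_blocks n a (p # ps) v =
     cross (p - a) (st (p - a) (\<lambda>i. v (a + i))) (st_blocks n p ps v)"

definition par :: "nat \<Rightarrow> nat set \<Rightarrow> (nat \<Rightarrow> nat) \<Rightarrow> nat \<Rightarrow> nat" where
  "par n S v = st_blocks n 0 (sorted_list_of_set S) v"


section \<open>The Moebius function of the weak order\<close>

lemma len_0_id:
  assumes w: "w permutes {1..n}" and "len n w = 0"
  shows "w = id"
proof (rule strict_mono_permutes_id[OF w])
  fix i j assume ij: "i \<in> {1..n}" "j \<in> {1..n}" "i < j"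
  have "finite {(i, j). i \<in> {1..n} \<and> j \<in> {1..n} \<and> i < j \<and> w i > w j}"
    by (rule finite_subset[of _ "{1..n} \<times> {1..n}"]) auto
  with assms(2) have "{(i, j). i \<in> {1..n} \<and> j \<in> {1..n} \<and> i < j \<and> w i > w j} = {}"
    by (simp add: len_def)
  with ij have "\<not> w i > w j" by blast
  moreover have "w i \<noteq> w j" using ij permutes_inj[OF w] by (auto dest: injD)
  ultimately show "w i < w j" by simp
qed

lemma weak_le_len_less:
  assumes "weak_le n z v" "z \<noteq> v"
  shows "len n z < len n v"
proof -
  from assms(1) obtain w where w: "w permutes {1..n}" "v = w \<circ> z" "len n v = len n w + len n z"
    by (auto simp: weak_le_def)
  have "len n w \<noteq> 0" using len_0_id[OF w(1)] w(2) assms(2) by auto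
  with w(3) show ?thesis by simp
qed

function mobius :: "nat \<Rightarrow> (nat \<Rightarrow> nat) \<Rightarrow> (nat \<Rightarrow> nat) \<Rightarrow> int" where
  "mobius n u v =
     (if u = v then 1
      else if weak_le n u v
        then - (\<Sum>z | weak_le n u z \<and> weak_le n z v \<and> z \<noteq> v. mobius n u z)
        else 0)"
  by pat_completeness auto
termination
  by (relation "measure (\<lambda>(n, u, v). len n v)") (auto intro: weak_le_len_less)

declare mobius.simps [simp del]


section \<open>The graded vector space\<close>

text \<open>
  The basis of the vector space is indexed by the disjoint union of all symmetric groups. The
  vector space itself consists of the finitely supported rational functions on this index type, and
  its tensor square of the finitely supported rational functions on pairs of indices.
\<close>

typedef gperm = "{(n, u). u permutes {1..n :: nat}}"
  by (rule exI[of _ "(0, id)"]) (simp add: permutes_id)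

definition deg :: "gperm \<Rightarrow> nat" where "deg x = fst (Rep_gperm x)"

definition fn :: "gperm \<Rightarrow> nat \<Rightarrow> nat" where "fn x = snd (Rep_gperm x)"

type_synonym ssym = "gperm \<Rightarrow>\<^sub>0 rat"
type_synonym ssym2 = "gperm \<times> gperm \<Rightarrow>\<^sub>0 rat"

definition smult :: "rat \<Rightarrow> ('a \<Rightarrow>\<^sub>0 rat) \<Rightarrow> ('a \<Rightarrow>\<^sub>0 rat)" where
  "smult c x = Poly_Mapping.map ((*) c) x"

lemma lookup_smult [simp]: "Poly_Mapping.lookup (smult c x) a = c * Poly_Mapping.lookup x a"
  by (simp add: smult_def Poly_Mapping.map.rep_eq when_def)

interpretation ssym: vector_space "smult :: rat \<Rightarrow> ('a \<Rightarrow>\<^sub>0 rat) \<Rightarrow> _"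
  by unfold_locales (auto intro!: poly_mapping_eqI simp: lookup_add algebra_simps)

text \<open>The linear map with prescribed values on the basis.\<close>

definition lin_ext :: "('a \<Rightarrow> ('b \<Rightarrow>\<^sub>0 rat)) \<Rightarrow> ('a \<Rightarrow>\<^sub>0 rat) \<Rightarrow> ('b \<Rightarrow>\<^sub>0 rat)" where
  "lin_ext f x = (\<Sum>a \<in> Poly_Mapping.keys x. smult (Poly_Mapping.lookup x a) (f a))"

text \<open>\<open>F_basis n u\<close> is only meaningful for \<open>u \<in> Sym n\<close>.\<close>

definition F_basis :: "nat \<Rightarrow> (nat \<Rightarrow> nat) \<Rightarrow> ssym" where
  "F_basis n u = Poly_Mapping.single (Abs_gperm (n, u)) 1"

definition M_basis :: "nat \<Rightarrow> (nat \<Rightarrow> nat) \<Rightarrow> ssym" where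
  "M_basis n u = (\<Sum>v | weak_le n u v. smult (of_int (mobius n u v)) (F_basis n v))"

definition tensor :: "ssym \<Rightarrow> ssym \<Rightarrow> ssym2" where
  "tensor x y = lin_ext (\<lambda>a. lin_ext (\<lambda>b. Poly_Mapping.single (a, b) 1) y) x"


section \<open>The Hopf algebra structure and its antipode\<close>

definition F_mult :: "nat \<Rightarrow> (nat \<Rightarrow> nat) \<Rightarrow> nat \<Rightarrow> (nat \<Rightarrow> nat) \<Rightarrow> ssym" where
  "F_mult p u q v = (\<Sum>\<zeta> \<in> Sym_Des (p + q) {p}. F_basis (p + q) (cross p u v \<circ> inv \<zeta>))"

definition F_comult :: "nat \<Rightarrow> (nat \<Rightarrow> nat) \<Rightarrow> ssym2" where
  "F_comult n u = (\<Sum>p = 0..n. tensor (F_basis p (st p u)) (F_basis (n - p) (st (n - p) (\<lambda>i. u (p + i)))))"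

definition mult :: "ssym2 \<Rightarrow> ssym" where
  "mult = lin_ext (\<lambda>(a, b). F_mult (deg a) (fn a) (deg b) (fn b))"

definition comult :: "ssym \<Rightarrow> ssym2" where
  "comult = lin_ext (\<lambda>a. F_comult (deg a) (fn a))"

text \<open>The unit element is the basis element of degree 0; the counit is the projection to degree 0.\<close>

definition one_ssym :: ssym where
  "one_ssym = F_basis 0 id"

definition counit :: "ssym \<Rightarrow> rat" where
  "counit x = Poly_Mapping.lookup x (Abs_gperm (0, id))"

text \<open>The map \<open>f \<otimes> g\<close>, for linear \<open>f\<close> and \<open>g\<close>.\<close>

definition tensor_map :: "(ssym \<Rightarrow> ssym) \<Rightarrow> (ssym \<Rightarrow> ssym) \<Rightarrow> ssym2 \<Rightarrow> ssym2" where
  "tensor_map f g =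
     lin_ext (\<lambda>(a, b). tensor (f (Poly_Mapping.single a 1)) (g (Poly_Mapping.single b 1)))"

definition convolution :: "(ssym \<Rightarrow> ssym) \<Rightarrow> (ssym \<Rightarrow> ssym) \<Rightarrow> ssym \<Rightarrow> ssym" where
  "convolution f g = mult \<circ> tensor_map f g \<circ> comult"

definition is_antipode :: "(ssym \<Rightarrow> ssym) \<Rightarrow> bool" where
  "is_antipode S \<longleftrightarrow> Vector_Spaces.linear smult smult S \<and>
     convolution S id = (\<lambda>x. smult (counit x) one_ssym) \<and>
     convolution id S = (\<lambda>x. smult (counit x) one_ssym)"

definition antipode :: "ssym \<Rightarrow> ssym" where
  "antipode = (THE S. is_antipode S)"


section \<open>The coefficients\<close>

definition kappa :: "nat \<Rightarrow> (nat \<Rightarrow> nat) \<Rightarrow> (nat \<Rightarrow> nat) \<Rightarrow> nat" where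
  "kappa n v w = card {\<zeta> \<in> Sym_Des n (GDes n v).
     weak_le n (par n (GDes n v) v \<circ> inv \<zeta>) w \<and>
     (\<forall>v' \<in> Sym n. weak_le n v v' \<and> weak_le n (par n (GDes n v) v' \<circ> inv \<zeta>) w \<longrightarrow> v' = v) \<and>
     (\<forall>R. Des n \<zeta> \<subseteq> R \<and> R \<subseteq> GDes n v \<and> weak_le n (par n R v \<circ> inv \<zeta>) w \<longrightarrow> R = GDes n v)}"

end

theory Submission
  imports Defs
begin

text \<open>
  In the fundamental basis the antipode is the alternating sum, over \<open>R \<subseteq> [n-1]\<close> and
  \<open>\<zeta>\<close> with \<open>Des \<zeta> \<subseteq> R\<close>, of the elements indexed by \<open>v\<^sub>R \<circ> inv \<zeta>\<close>. By Moebius inversion it suffices to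
  match, for fixed \<open>w\<close> and \<open>\<zeta>\<close>, the signed number of \<open>R \<supseteq> Des \<zeta>\<close> with \<open>v\<^sub>R \<circ> inv \<zeta> \<le> w\<close> against the
  signed number of \<open>y \<ge> v\<close> for which \<open>\<zeta>\<close> is counted by \<open>\<kappa>(y, w)\<close>. For \<open>inv \<zeta> \<le> w\<close> and \<open>x = w \<circ> \<zeta>\<close> the
  condition on \<open>R\<close> reads \<open>v \<le> g\<^sub>R\<close>, where \<open>g\<^sub>R\<close> has the relative order of \<open>x\<close> inside the blocks of \<open>R\<close> and all
  inversions between different blocks. The sets \<open>R\<close> with a given value \<open>g\<^sub>R = y\<close> form a Boolean interval
  with top element \<open>GDes y\<close>; the interval cancels unless it is a single point, which is precisely
  conditions (i)-(iii).
\<close>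

section \<open>Words and standardization\<close>

lemma finite_Sym [simp]: "finite (Sym n)"
  by (simp add: finite_permutations)

lemma Sym_eqI:
  assumes "u \<in> Sym n" "v \<in> Sym n"
    and "\<And>i j. i \<in> {1..n} \<Longrightarrow> j \<in> {1..n} \<Longrightarrow> i < j \<Longrightarrow> u i < u j \<longleftrightarrow> v i < v j"
  shows "u = v"
proof -
  have u: "u permutes {1..n}" and v: "v permutes {1..n}" using assms by auto
  have "inj_on v {1..n}" using v by (simp add: permutes_inj_on)
  from st_unique_existence[OF this] have *: "\<And>x y. (x \<in> Sym n \<and> (\<forall>i\<in>{1..n}. \<forall>j\<in>{1..n}. (x i < x j) = (v i < v j))) \<Longrightarrow>
     (y \<in> Sym n \<and> (\<forall>i\<in>{1..n}. \<forall>j\<in>{1..n}. (y i < y j) = (v i < v j))) \<Longrightarrow> x = y" by blast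
  have "u i < u j \<longleftrightarrow> v i < v j" if "i \<in> {1..n}" "j \<in> {1..n}" for i j
  proof (cases i j rule: linorder_cases)
    case greater
    have "u i \<noteq> u j" "v i \<noteq> v j" using greater inj_eq permutes_inj[OF u] permutes_inj[OF v]
      by (metis less_irrefl)+
    with assms(3)[OF that(2,1) greater] show ?thesis by auto
  qed (use assms(3) that in auto)
  with *[of u v] assms(1,2) show ?thesis by auto
qed

lemma
  assumes "inj_on a {1..p}"
  shows st_in_Sym: "st p a \<in> Sym p"
    and st_less_iff: "\<And>i j. i \<in> {1..p} \<Longrightarrow> j \<in> {1..p} \<Longrightarrow> st p a i < st p a j \<longleftrightarrow> a i < a j"
  using theI'[OF st_unique_existence[OF assms]] unfolding st_def by auto

lemma st_eqI:
  assumes "u \<in> Sym p" "inj_on a {1..p}"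
    and "\<And>i j. i \<in> {1..p} \<Longrightarrow> j \<in> {1..p} \<Longrightarrow> i < j \<Longrightarrow> u i < u j \<longleftrightarrow> a i < a j"
  shows "st p a = u"
  using assms st_in_Sym[OF assms(2)] st_less_iff[OF assms(2)] by (intro Sym_eqI[of _ p]) auto

lemma Sym_less_cases:
  assumes "u \<in> Sym n" "i \<noteq> j" shows "u i < u j \<or> u j < u i"
  using assms by (metis injD linorder_neqE_nat mem_Collect_eq permutes_inj)

lemma Sym_in_range:
  assumes "u \<in> Sym n" shows "u i \<in> {1..n} \<longleftrightarrow> i \<in> {1..n}"
  using assms by (simp add: permutes_in_image del: atLeastAtMost_iff)

lemma Sym_inv: "u \<in> Sym n \<Longrightarrow> inv u \<in> Sym n"
  by (simp add: permutes_inv)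

lemma Sym_comp: "u \<in> Sym n \<Longrightarrow> v \<in> Sym n \<Longrightarrow> u \<circ> v \<in> Sym n"
  by (simp add: permutes_compose)

lemma Sym_inj_on: "u \<in> Sym n \<Longrightarrow> inj_on u A"
  using permutes_inj_on by auto

lemma Sym_inv_simps:
  assumes "u \<in> Sym n" shows "u (inv u i) = i" "inv u (u i) = i"
  using assms permutes_inverses by fastforce+

section \<open>The weak order by inversion sets\<close>

text \<open>Pairs of positions, not of values: the weak order multiplies on the left, which changes
  values and leaves positions in place.\<close>

definition Inv :: "nat \<Rightarrow> (nat \<Rightarrow> nat) \<Rightarrow> (nat \<times> nat) set" where
  "Inv n u = {(i, j). i \<in> {1..n} \<and> j \<in> {1..n} \<and> i < j \<and> u i > u j}"

lemma finite_Inv [simp]: "finite (Inv n u)"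
  by (rule finite_subset[of _ "{1..n} \<times> {1..n}"]) (auto simp: Inv_def)

lemma Inv_inject:
  assumes "u \<in> Sym n" "v \<in> Sym n" "Inv n u = Inv n v" shows "u = v"
proof (rule Sym_eqI[OF assms(1,2)])
  fix i j assume ij: "i \<in> {1..n}" "j \<in> {1..n}" "i < j"
  have "(i, j) \<in> Inv n u \<longleftrightarrow> (i, j) \<in> Inv n v" using assms(3) by simp
  then show "u i < u j \<longleftrightarrow> v i < v j"
    using ij Sym_less_cases[OF assms(1), of i j] Sym_less_cases[OF assms(2), of i j]
    by (auto simp: Inv_def)
qed

text \<open>An inversion of \<open>v \<circ> inv u\<close> is a pair of values of \<open>u\<close>
  which \<open>v\<close> orders the other way. Pulled back along \<open>u\<close> it becomes a pair
  of positions that is an inversion of exactly one of \<open>u\<close> and \<open>v\<close>.\<close>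

lemma len_comp_inv:
  assumes u: "u \<in> Sym n" and v: "v \<in> Sym n"
  shows "len n (v \<circ> inv u) = card ((Inv n u - Inv n v) \<union> (Inv n v - Inv n u))"
proof -
  let ?w = "v \<circ> inv u" and ?D = "(Inv n u - Inv n v) \<union> (Inv n v - Inv n u)"
  \<comment> \<open>Transport along \<open>inv u\<close> and \<open>u\<close> may swap the two
    entries, so \<open>min\<close> and \<open>max\<close> put the smaller one first again.\<close>
  let ?f = "\<lambda>(a, b). (min (inv u a) (inv u b), max (inv u a) (inv u b))"
  let ?g = "\<lambda>(i, j). (min (u i) (u j), max (u i) (u j))"
  note iu = Sym_inv_simps[OF u]
  have r: "inv u i \<in> {1..n} \<longleftrightarrow> i \<in> {1..n}" "u i \<in> {1..n} \<longleftrightarrow> i \<in> {1..n}" for i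
    using Sym_in_range[OF u] Sym_in_range[OF Sym_inv[OF u]] by blast+
  have "bij_betw ?f (Inv n ?w) ?D"
  proof (rule bij_betw_byWitness[of _ ?g])
    show "\<forall>x\<in>Inv n ?w. ?g (?f x) = x"
    proof
      fix x assume "x \<in> Inv n ?w"
      then obtain a b where "x = (a, b)" "a < b" by (auto simp: Inv_def)
      then show "?g (?f x) = x" by (simp add: min_def max_def iu)
    qed
    show "\<forall>x\<in>?D. ?f (?g x) = x"
    proof
      fix x assume "x \<in> ?D"
      then obtain i j where "x = (i, j)" "i < j" by (auto simp: Inv_def)
      then show "?f (?g x) = x" by (simp add: min_def max_def iu)
    qed
    have "?f (a, b) \<in> ?D" if "(a, b) \<in> Inv n ?w" for a b
    proof -
      from that have m: "a \<in> {1..n}" "b \<in> {1..n}" "a < b" "v (inv u b) < v (inv u a)"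
        by (simp_all add: Inv_def)
      have rr: "inv u a \<in> {1..n}" "inv u b \<in> {1..n}" using m(1,2) r(1) by blast+
      consider "inv u a < inv u b" | "inv u b < inv u a"
        using Sym_less_cases[OF Sym_inv[OF u], of a b] m(3) by blast
      then show "?f (a, b) \<in> ?D"
        by cases (use m(3,4) rr iu in \<open>simp_all add: Inv_def min_def max_def\<close>)
    qed
    note * = this
    show "?f ` Inv n ?w \<subseteq> ?D"
    proof (rule image_subsetI)
      fix x assume x: "x \<in> Inv n ?w"
      obtain a b where e: "x = (a, b)" by (cases x)
      show "?f x \<in> ?D" using * x unfolding e .
    qed
    have "?g (i, j) \<in> Inv n ?w" if ij: "(i, j) \<in> ?D" for i j
    proof -
      from ij have m: "i \<in> {1..n}" "j \<in> {1..n}" "i < j" by (auto simp: Inv_def)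
      have rr: "u i \<in> {1..n}" "u j \<in> {1..n}" using m(1,2) r(2) by blast+
      have ne: "v i < v j \<or> v j < v i" using Sym_less_cases[OF v, of i j] m(3) by blast
      consider "u i < u j" | "u j < u i"
        using Sym_less_cases[OF u, of i j] m(3) by blast
      then show "?g (i, j) \<in> Inv n ?w"
        by cases (use ij m ne rr iu in \<open>auto simp: Inv_def min_def max_def\<close>)
    qed
    note * = this
    show "?g ` ?D \<subseteq> Inv n ?w"
    proof (rule image_subsetI)
      fix x assume x: "x \<in> ?D"
      obtain a b where e: "x = (a, b)" by (cases x)
      show "?g x \<in> Inv n ?w" using * x unfolding e .
    qed
  qed
  then show ?thesis by (simp add: bij_betw_same_card len_def Inv_def)
qed

text \<open>The only possible left factor is \<open>v \<circ> inv u\<close>. Its length is the size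
  of the symmetric difference of the two inversion sets, so lengths add up exactly when no inversion
  of \<open>u\<close> is lost.\<close>

lemma weak_le_iff: "weak_le n u v \<longleftrightarrow> u \<in> Sym n \<and> v \<in> Sym n \<and> Inv n u \<subseteq> Inv n v"
proof -
  have "weak_le n u v \<longleftrightarrow> Inv n u \<subseteq> Inv n v" if u: "u \<in> Sym n" and v: "v \<in> Sym n"
  proof -
    have "weak_le n u v \<longleftrightarrow> len n v = len n (v \<circ> inv u) + len n u"
    proof
      assume "weak_le n u v"
      then obtain w where w: "v = w \<circ> u" "len n v = len n w + len n u" by (auto simp: weak_le_def)
      moreover have "v \<circ> inv u = w" using w(1) Sym_inv_simps[OF u] by (simp add: fun_eq_iff)
      ultimately show "len n v = len n (v \<circ> inv u) + len n u" by simp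
    next
      assume "len n v = len n (v \<circ> inv u) + len n u"
      moreover have "v = v \<circ> inv u \<circ> u" using Sym_inv_simps[OF u] by (simp add: fun_eq_iff)
      moreover have "v \<circ> inv u \<in> Sym n" by (intro Sym_comp Sym_inv u v)
      ultimately show "weak_le n u v" using u v unfolding weak_le_def by blast
    qed
    also have "\<dots> \<longleftrightarrow> Inv n u \<subseteq> Inv n v"
    proof -
      let ?A = "Inv n u" and ?B = "Inv n v"
      have l: "len n u = card ?A" "len n v = card ?B" by (simp_all add: len_def Inv_def)
      have c: "card ((?A - ?B) \<union> (?B - ?A)) = card (?A - ?B) + card (?B - ?A)"
        by (subst card_Un_disjoint) auto
      have "card ?A = card (?A - ?B) + card (?A \<inter> ?B)"
        by (metis card_Diff_subset_Int finite_Inv finite_Int Int_lower1 card_mono le_add_diff_inverse2)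
      moreover have "card ?B = card (?B - ?A) + card (?A \<inter> ?B)"
        by (metis card_Diff_subset_Int finite_Inv finite_Int Int_commute Int_lower1 card_mono le_add_diff_inverse2)
      moreover have "card (?A - ?B) = 0 \<longleftrightarrow> ?A \<subseteq> ?B" by auto
      ultimately show ?thesis unfolding len_comp_inv[OF u v] l c by linarith
    qed
    finally show ?thesis .
  qed
  moreover have "weak_le n u v \<Longrightarrow> u \<in> Sym n \<and> v \<in> Sym n" by (simp add: weak_le_def)
  ultimately show ?thesis by blast
qed

lemma weak_le_refl: "u \<in> Sym n \<Longrightarrow> weak_le n u u"
  by (simp add: weak_le_iff)

lemma weak_le_trans: "weak_le n u v \<Longrightarrow> weak_le n v w \<Longrightarrow> weak_le n u w"
  by (auto simp: weak_le_iff)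

lemma weak_le_antisym: "weak_le n u v \<Longrightarrow> weak_le n v u \<Longrightarrow> u = v"
  by (auto simp: weak_le_iff intro: Inv_inject)

lemma weak_le_Sym: "weak_le n u v \<Longrightarrow> u \<in> Sym n" "weak_le n u v \<Longrightarrow> v \<in> Sym n"
  by (auto simp: weak_le_iff)

lemma finite_weak_ge [simp]: "finite {v. weak_le n u v}"
  by (rule finite_subset[OF _ finite_Sym[of n]]) (auto simp: weak_le_iff)

section \<open>Products and block standardizations of permutations\<close>

lemma cross_Sym:
  assumes "u \<in> Sym p" "v \<in> Sym q" shows "cross p u v \<in> Sym (p + q)"
proof -
  have r: "u i \<in> {1..p} \<longleftrightarrow> i \<in> {1..p}" "v i \<in> {1..q} \<longleftrightarrow> i \<in> {1..q}" for i
    using Sym_in_range assms by blast+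
  have "inj_on (cross p u v) {1..p+q}"
  proof (rule inj_onI)
    fix i j assume ij: "i \<in> {1..p+q}" "j \<in> {1..p+q}" and e: "cross p u v i = cross p u v j"
    have "u i = u j \<Longrightarrow> i = j" "v (i-p) = v (j-p) \<Longrightarrow> i - p = j - p" 
      using assms by (auto dest: permutes_inj injD)
    then show "i = j" using e ij r(1)[of i] r(1)[of j] r(2)[of "i - p"] r(2)[of "j - p"]
      by (auto simp: cross_def split: if_splits)
  qed
  moreover have "cross p u v ` {1..p+q} \<subseteq> {1..p+q}"
  proof clarify
    fix i assume "i \<in> {1..p+q}"
    then show "cross p u v i \<in> {1..p+q}" using r(1)[of i] r(2)[of "i - p"] by (auto simp: cross_def)
  qed
  ultimately have "bij_betw (cross p u v) {1..p+q} {1..p+q}"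
    by (simp add: bij_betw_def endo_inj_surj)
  moreover have "cross p u v i = i" if "i \<notin> {1..p+q}" for i
  proof (cases "i \<le> p")
    case True
    then have "i \<notin> {1..p}" using that by auto
    then show ?thesis using assms True by (auto simp: cross_def permutes_def)
  next
    case False
    then have "i - p \<notin> {1..q}" using that by auto
    then have "v (i - p) = i - p" using assms(2) unfolding permutes_def by blast
    then show ?thesis using False by (auto simp: cross_def)
  qed
  ultimately have "cross p u v permutes {1..p + q}" by (rule bij_imp_permutes)
  then show ?thesis by simp
qed

lemma cross_comp:
  assumes "u' \<in> Sym p" "v' \<in> Sym q"
  shows "cross p u v \<circ> cross p u' v' = cross p (u \<circ> u') (v \<circ> v')"
proof
  fix i
  have r: "u' i \<in> {1..p} \<longleftrightarrow> i \<in> {1..p}" "v' (i - p) \<in> {1..q} \<longleftrightarrow> (i - p) \<in> {1..q}"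
    using Sym_in_range assms by blast+
  \<comment> \<open>The equality is claimed at every index: 0 falls into the first branch of
    \<open>cross\<close> and indices beyond \<open>p + q\<close> into the second, where the inner
    factors act trivially.\<close>
  have z: "u' 0 = 0" "i - p \<notin> {1..q} \<Longrightarrow> v' (i-p) = i-p"
    using assms permutes_not_in[of u' "{1..p}" 0] permutes_not_in[of v' "{1..q}" "i - p"] by auto
  show "(cross p u v \<circ> cross p u' v') i = cross p (u \<circ> u') (v \<circ> v') i"
    using r z by (cases "i = 0"; cases "i - p \<in> {1..q}") (auto simp: cross_def)
qed

lemma cross_id: "cross p id id = id"
  by (auto simp: cross_def)

lemma inv_cross:
  assumes "u \<in> Sym p" "v \<in> Sym q"
  shows "inv (cross p u v) = cross p (inv u) (inv v)"
proof (rule inv_unique_comp)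
  have [simp]: "u \<circ> inv u = id" "inv u \<circ> u = id" "v \<circ> inv v = id" "inv v \<circ> v = id"
    using Sym_inv_simps assms by (auto simp: fun_eq_iff)
  show "cross p u v \<circ> cross p (inv u) (inv v) = id" "cross p (inv u) (inv v) \<circ> cross p u v = id"
    using assms by (simp_all only: cross_comp[OF Sym_inv Sym_inv] cross_comp) (simp_all add: cross_id)
qed

lemma cross_less_iff:
  assumes "u \<in> Sym p" "v \<in> Sym q" "i \<in> {1..p+q}" "j \<in> {1..p+q}" "i < j"
  shows "cross p u v i < cross p u v j \<longleftrightarrow>
    (if j \<le> p then u i < u j else if p < i then v (i - p) < v (j - p) else True)"
proof -
  have r: "u i \<in> {1..p} \<longleftrightarrow> i \<in> {1..p}" "v (j - p) \<in> {1..q} \<longleftrightarrow> (j - p) \<in> {1..q}"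
    using Sym_in_range assms by blast+
  show ?thesis using assms(3-5) r by (auto simp: cross_def)
qed

text \<open>A cut \<open>p\<close> lies between the positions \<open>p\<close> and
  \<open>p + 1\<close>, so \<open>i < j\<close> share a block iff no cut is in
  \<open>{i..<j}\<close>. Positions in different blocks always get increasing values. The offset
  \<open>a\<close> makes the claim inductive: each recursive call numbers its positions from 1
  again.\<close>

lemma st_blocks_props:
  assumes "sorted_wrt (<) (a # ps)" "\<forall>p\<in>set (a # ps). p \<le> n" "inj_on v {a+1..n}"
  shows "st_blocks n a ps v \<in> Sym (n - a) \<and> (\<forall>i\<in>{1..n-a}. \<forall>j\<in>{1..n-a}. i < j \<longrightarrow>
    (st_blocks n a ps v i < st_blocks n a ps v j \<longleftrightarrow>
     (set ps \<inter> {a+i..<a+j} = {} \<longrightarrow> v (a+i) < v (a+j))))"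
  using assms
proof (induction ps arbitrary: a)
  case Nil
  have "inj_on (\<lambda>i. v (a + i)) {1..n-a}"
  proof (rule inj_onI)
    fix x y assume "x \<in> {1..n-a}" "y \<in> {1..n-a}" "v (a + x) = v (a + y)"
    then have "a + x = a + y" by - (rule inj_onD[OF Nil.prems(3)], auto)
    then show "x = y" by simp
  qed
  note u = st_in_Sym[OF this] st_less_iff[OF this]
  show ?case using u(1) by (simp add: u(2))
next
  case (Cons p ps)
  let ?u = "st (p - a) (\<lambda>i. v (a + i))" and ?v = "st_blocks n p ps v"
  have ap: "a < p" "p \<le> n" and ps: "\<forall>x\<in>set ps. p < x" using Cons.prems by auto
  have "inj_on v {p+1..n}" using Cons.prems(3) ap by (auto intro: inj_on_subset)
  then have IH: "?v \<in> Sym (n - p)"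
    "\<And>i j. i\<in>{1..n-p} \<Longrightarrow> j\<in>{1..n-p} \<Longrightarrow> i < j \<Longrightarrow> (?v i < ?v j \<longleftrightarrow> 
       (set ps \<inter> {p+i..<p+j} = {} \<longrightarrow> v (p+i) < v (p+j)))"
    using Cons.IH[of p] Cons.prems by auto
  have inj: "inj_on (\<lambda>i. v (a + i)) {1..p-a}"
  proof (rule inj_onI)
    fix x y assume "x \<in> {1..p-a}" "y \<in> {1..p-a}" "v (a + x) = v (a + y)"
    then have "a + x = a + y" using ap by - (rule inj_onD[OF Cons.prems(3)], auto)
    then show "x = y" by simp
  qed
  note u = st_in_Sym[OF inj] st_less_iff[OF inj]
  have n: "p - a + (n - p) = n - a" using ap by simp
  show ?case
  proof (intro conjI ballI impI)
    show "st_blocks n a (p # ps) v \<in> Sym (n - a)"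
      using cross_Sym[OF u(1) IH(1)] n by simp
    fix i j assume ij: "i \<in> {1..n-a}" "j \<in> {1..n-a}" "i < j"
    have *: "st_blocks n a (p # ps) v i < st_blocks n a (p # ps) v j \<longleftrightarrow>
      (if j \<le> p - a then ?u i < ?u j else if p - a < i then ?v (i - (p - a)) < ?v (j - (p - a)) else True)"
      using cross_less_iff[OF u(1) IH(1), of i j] ij n by simp
    consider "j \<le> p - a" | "p - a < i" | "i \<le> p - a" "p - a < j" by linarith
    then show "st_blocks n a (p # ps) v i < st_blocks n a (p # ps) v j \<longleftrightarrow>
     (set (p # ps) \<inter> {a+i..<a+j} = {} \<longrightarrow> v (a+i) < v (a+j))"
    proof cases
      case 1
      then have "set (p # ps) \<inter> {a+i..<a+j} = {}" using ps by fastforce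
      then show ?thesis unfolding * using u(2)[of i j] 1 ij by simp
    next
      case 2
      have [simp]: "p + (i - (p - a)) = a + i" "p + (j - (p - a)) = a + j" using 2 ij ap by auto
      have "p \<notin> {a+i..<a+j}" using 2 by auto
      then show ?thesis unfolding * using IH(2)[of "i - (p - a)" "j - (p - a)"] 2 ij by auto
    next
      case 3
      then have "p \<in> set (p # ps) \<inter> {a+i..<a+j}" using ap by auto
      then show ?thesis unfolding * using 3 by auto
    qed
  qed
qed

lemma
  assumes "R \<subseteq> {1..<n}" "v \<in> Sym n"
  shows par_Sym: "par n R v \<in> Sym n"
    and par_less_iff: "\<And>i j. i \<in> {1..n} \<Longrightarrow> j \<in> {1..n} \<Longrightarrow> i < j \<Longrightarrow>
      par n R v i < par n R v j \<longleftrightarrow> (R \<inter> {i..<j} = {} \<longrightarrow> v i < v j)"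
proof -
  have f: "finite R" using assms(1) finite_subset by blast
  have "0 < x" "x \<le> n" if "x \<in> R" for x using assms(1) that by auto
  then have "sorted_wrt (<) (0 # sorted_list_of_set R)" "\<forall>p\<in>set (0 # sorted_list_of_set R). p \<le> n"
    using f by auto
  from st_blocks_props[OF this Sym_inj_on[OF assms(2)]]
  show "par n R v \<in> Sym n" "\<And>i j. i \<in> {1..n} \<Longrightarrow> j \<in> {1..n} \<Longrightarrow> i < j \<Longrightarrow>
      par n R v i < par n R v j \<longleftrightarrow> (R \<inter> {i..<j} = {} \<longrightarrow> v i < v j)"
    using f by (auto simp: par_def)
qed

text \<open>Inside a block of \<open>R\<close> each step from \<open>k\<close> to
  \<open>k + 1\<close> is an ascent; these steps are chained.\<close>

lemma Sym_Des_mono: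
  assumes z: "\<zeta> \<in> Sym n" "Des n \<zeta> \<subseteq> R" and ij: "i \<in> {1..n}" "j \<in> {1..n}" "i < j" "R \<inter> {i..<j} = {}"
  shows "\<zeta> i < \<zeta> j"
proof -
  have "Suc i \<le> j" using ij by simp
  then show ?thesis using ij(2,4)
  proof (induction j rule: dec_induct)
    case base
    have "i \<notin> Des n \<zeta>" using z base by auto
    then show ?case using base ij(1) Sym_less_cases[OF z(1), of i "Suc i"] by (auto simp: Des_def)
  next
    case (step k)
    have "k \<notin> Des n \<zeta>" using z step by auto
    then have "\<zeta> k < \<zeta> (Suc k)" using step ij(1) Sym_less_cases[OF z(1), of k "Suc k"]
      by (auto simp: Des_def)
    moreover have "\<zeta> i < \<zeta> k" using step by (intro step.IH) auto
    ultimately show ?case by simp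
  qed
qed

section \<open>Fibres of the adjoint of block standardization\<close>

text \<open>Global descents depend on the inversion set only, and that is what
  \<open>Inv_blk\<close> computes for \<open>blk\<close>.\<close>

lemma GDes_Inv:
  "GDes n u = {p \<in> {1..<n}. \<forall>i \<in> {1..p}. \<forall>j \<in> {p+1..n}. (i, j) \<in> Inv n u}"
  by (auto simp: GDes_def Inv_def)

text \<open>
  The adjoint of \<open>par n R\<close>: for \<open>x\<close> in the symmetric group, \<open>blk n R x\<close> is the largest \<open>v\<close>
  with \<open>v\<^sub>R \<le> x\<close>. The two subtractions from \<open>n\<close> reverse the order of the values, which turns the
  increasing arrangement of the blocks produced by \<open>par\<close> into a decreasing one.
\<close>

definition blk :: "nat \<Rightarrow> nat set \<Rightarrow> (nat \<Rightarrow> nat) \<Rightarrow> nat \<Rightarrow> nat" where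
  "blk n R x = st n (\<lambda>i. n - par n R (st n (\<lambda>i. n - x i)) i)"

lemma
  assumes x: "x \<in> Sym n" and R: "R \<subseteq> {1..<n}"
  shows blk_Sym: "blk n R x \<in> Sym n"
    and Inv_blk: "Inv n (blk n R x) =
      {(i, j). i \<in> {1..n} \<and> j \<in> {1..n} \<and> i < j \<and> (R \<inter> {i..<j} = {} \<longrightarrow> (i, j) \<in> Inv n x)}"
proof -
  \<comment> \<open>Subtraction is truncated, but values at positions in \<open>{1..n}\<close> are
    at most \<open>n\<close>, so it reverses their order without collisions.\<close>
  have rev: "inj_on (\<lambda>i. n - y i) {1..n}"
    "\<And>i j. i \<in> {1..n} \<Longrightarrow> j \<in> {1..n} \<Longrightarrow> n - y i < n - y j \<longleftrightarrow> y j < y i" if "y \<in> Sym n" for y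
  proof -
    have le: "y i \<le> n" if "i \<in> {1..n}" for i using Sym_in_range[OF \<open>y \<in> Sym n\<close>, of i] that by simp
    show "inj_on (\<lambda>i. n - y i) {1..n}"
    proof (rule inj_onI)
      fix i j assume ij: "i \<in> {1..n}" "j \<in> {1..n}" and e: "n - y i = n - y j"
      then have "y i = y j" using le[OF ij(1)] le[OF ij(2)] by simp
      then show "i = j" using Sym_less_cases[OF \<open>y \<in> Sym n\<close>, of i j] by auto
    qed
    show "n - y i < n - y j \<longleftrightarrow> y j < y i" if ij: "i \<in> {1..n}" "j \<in> {1..n}" for i j
      using le[OF ij(1)] le[OF ij(2)] by linarith
  qed
  let ?y = "st n (\<lambda>i. n - x i)"
  have y: "?y \<in> Sym n" "\<And>i j. i \<in> {1..n} \<Longrightarrow> j \<in> {1..n} \<Longrightarrow> ?y i < ?y j \<longleftrightarrow> x j < x i"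
    using st_in_Sym[OF rev(1)[OF x]] st_less_iff[OF rev(1)[OF x]] rev(2)[OF x] by simp_all
  note p = par_Sym[OF R y(1)] par_less_iff[OF R y(1)]
  note b = st_in_Sym[OF rev(1)[OF p(1)]] st_less_iff[OF rev(1)[OF p(1)]]
  show "blk n R x \<in> Sym n" unfolding blk_def by (rule b(1))
  show "Inv n (blk n R x) =
      {(i, j). i \<in> {1..n} \<and> j \<in> {1..n} \<and> i < j \<and> (R \<inter> {i..<j} = {} \<longrightarrow> (i, j) \<in> Inv n x)}"
  proof -
    have "blk n R x j < blk n R x i \<longleftrightarrow> (R \<inter> {i..<j} = {} \<longrightarrow> x j < x i)"
      if ij: "i \<in> {1..n}" "j \<in> {1..n}" "i < j" for i j
    proof -
      have "blk n R x j < blk n R x i \<longleftrightarrow> par n R ?y i < par n R ?y j"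
        unfolding blk_def b(2)[OF ij(2,1)] by (rule rev(2)[OF p(1) ij(2,1)])
      then show ?thesis using p(2)[OF ij] y(2)[OF ij(1,2)] by simp
    qed
    then show ?thesis by (auto simp: Inv_def)
  qed
qed

text \<open>A larger set cuts more pairs, and every cut pair is an inversion of
  \<open>blk\<close>.\<close>

lemma blk_mono:
  assumes "x \<in> Sym n" "R \<subseteq> R'" "R' \<subseteq> {1..<n}"
  shows "weak_le n (blk n R x) (blk n R' x)"
proof -
  have R: "R \<subseteq> {1..<n}" using assms by blast
  show ?thesis unfolding weak_le_iff Inv_blk[OF assms(1,3)] Inv_blk[OF assms(1) R]
    using blk_Sym[OF assms(1,3)] blk_Sym[OF assms(1) R] assms(2) by blast
qed

lemma GDes_blk:
  assumes x: "x \<in> Sym n" and R: "R \<subseteq> {1..<n}"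
  shows "R \<subseteq> GDes n (blk n R x)"
  unfolding GDes_Inv Inv_blk[OF x R] using R by fastforce

text \<open>Cutting also at the remaining global descents of \<open>blk n R x\<close> forces only
  inversions that are present already. With \<open>GDes_blk\<close> this makes the set of global
  descents the largest element of the fibre.\<close>

lemma blk_GDes_blk:
  assumes x: "x \<in> Sym n" and R: "R \<subseteq> {1..<n}"
  shows "blk n (GDes n (blk n R x)) x = blk n R x"
proof -
  let ?y = "blk n R x" and ?S = "GDes n (blk n R x)"
  have y: "?y \<in> Sym n" by (rule blk_Sym[OF x R])
  have S: "?S \<subseteq> {1..<n}" by (auto simp: GDes_def)
  have "weak_le n (blk n ?S x) ?y"
    unfolding weak_le_iff
  proof (intro conjI blk_Sym x S R subsetI)
    fix q assume "q \<in> Inv n (blk n ?S x)"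
    then obtain i j where q: "q = (i, j)" and ij: "i \<in> {1..n}" "j \<in> {1..n}" "i < j"
      and c: "?S \<inter> {i..<j} = {} \<longrightarrow> (i, j) \<in> Inv n x" unfolding Inv_blk[OF x S] by blast
    show "q \<in> Inv n ?y"
    proof (cases "?S \<inter> {i..<j} = {}")
      case True
      then show ?thesis using c ij unfolding Inv_blk[OF x R] q by blast
    next
      case False
      then obtain p where "p \<in> ?S" "i \<le> p" "p < j" by auto
      then show ?thesis using ij unfolding q GDes_Inv by auto
    qed
  qed
  moreover have "weak_le n ?y (blk n ?S x)" by (rule blk_mono[OF x GDes_blk[OF x R] S])
  ultimately show ?thesis by (rule weak_le_antisym)
qed

section \<open>Signed sums over the fibres of \<open>blk\<close>\<close>

lemma sum_involution_zero:
  fixes f :: "'a \<Rightarrow> rat"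
  assumes "\<And>a. a \<in> A \<Longrightarrow> t a \<in> A" "\<And>a. a \<in> A \<Longrightarrow> t (t a) = a" "\<And>a. a \<in> A \<Longrightarrow> f (t a) = - f a"
  shows "sum f A = 0"
proof -
  \<comment> \<open>A fixed point of \<open>t\<close> causes no trouble: there \<open>f\<close>
    equals its own negative and vanishes.\<close>
  have "sum f A = (\<Sum>a\<in>A. f (t a))"
    by (rule sum.reindex_bij_witness[of _ t t]) (use assms in auto)
  also have "\<dots> = - sum f A" using assms(3) by (simp add: sum_negf)
  finally show ?thesis by simp
qed

text \<open>
  Together with the upward closure of the fibres, this makes a fibre of \<open>R \<mapsto> blk n R x\<close> a Boolean
  interval. The reason: once \<open>p\<close> is removed, a pair \<open>i \<le> p < j\<close> that becomes comparable satisfies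
  \<open>x i > x p > x (p + 1) > x j\<close>, up to dropping the steps within one block of \<open>S\<close>.
\<close>

lemma blk_remove:
  assumes x: "x \<in> Sym n" and S: "S \<subseteq> {1..<n}" and R: "R \<subseteq> S" and p: "p \<in> R"
    and e1: "blk n (S - {p}) x = blk n S x" and e2: "blk n R x = blk n S x"
  shows "blk n (R - {p}) x = blk n S x"
proof -
  have Rn: "R \<subseteq> {1..<n}" and Sp: "S - {p} \<subseteq> {1..<n}" and Rp: "R - {p} \<subseteq> {1..<n}"
    using S R by blast+
  have pn: "1 \<le> p" "p < n" using p Rn by auto
  \<comment> \<open>In both listed cases \<open>Q\<close> and \<open>Q'\<close> give the same
    \<open>blk\<close>, so a pair cut by \<open>Q'\<close> but not by \<open>Q\<close> must already
    be an inversion of \<open>x\<close>.\<close>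
  have gt: "x j < x i" if "i \<in> {1..n}" "j \<in> {1..n}" "i < j" "(Q, Q') \<in> {(S - {p}, S), (R, S)}"
    "Q \<inter> {i..<j} = {}" "Q' \<inter> {i..<j} \<noteq> {}" for i j Q Q'
  proof -
    have Q: "Q \<subseteq> {1..<n}" "Q' \<subseteq> {1..<n}" "blk n Q x = blk n Q' x"
      using that(4) S R e1 e2 by auto
    have "(i, j) \<in> Inv n (blk n Q' x)" using that unfolding Inv_blk[OF x Q(2)] by blast
    then show ?thesis using that unfolding Q(3)[symmetric] Inv_blk[OF x Q(1)] by (auto simp: Inv_def)
  qed
  have "Inv n (blk n (R - {p}) x) = Inv n (blk n R x)"
  proof
    show "Inv n (blk n (R - {p}) x) \<subseteq> Inv n (blk n R x)"
      using blk_mono[OF x, of "R - {p}" R] Rn by (auto simp: weak_le_iff)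
    show "Inv n (blk n R x) \<subseteq> Inv n (blk n (R - {p}) x)"
    proof
      fix q assume q: "q \<in> Inv n (blk n R x)"
      then obtain i j where ij: "q = (i, j)" "i \<in> {1..n}" "j \<in> {1..n}" "i < j"
        and c: "R \<inter> {i..<j} = {} \<longrightarrow> (i, j) \<in> Inv n x"
        unfolding Inv_blk[OF x Rn] by blast
      have "x j < x i" if em: "(R - {p}) \<inter> {i..<j} = {}"
      proof (cases "R \<inter> {i..<j} = {}")
        case True
        then show ?thesis using c by (auto simp: Inv_def)
      next
        case False
        then have pij: "i \<le> p" "p < j" using em by auto
        \<comment> \<open>In \<open>{i..<j}\<close> the set \<open>R\<close> contains
          \<open>p\<close> alone, hence \<open>gt\<close> with \<open>R\<close> and \<open>S\<close>
          applies on either side of \<open>p\<close>.\<close>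
        have Rip: "R \<inter> {i..<p} = {}" and Rpj: "R \<inter> {Suc p..<j} = {}"
          using em pij by fastforce+
        have x1: "S \<inter> {i..<p} \<noteq> {} \<Longrightarrow> x p < x i"
          using gt[of i p R S] ij pij Rip pn by (cases "i = p") auto
        have x2: "S \<inter> {Suc p..<j} \<noteq> {} \<Longrightarrow> x j < x (Suc p)"
          using gt[of "Suc p" j R S] ij pij Rpj pn by (cases "j = Suc p") auto
        have Sp1: "(S - {p}) \<inter> {a..<b} = {} \<longleftrightarrow> S \<inter> {a..<p} = {} \<and> S \<inter> {Suc p..<b} = {}"
          if "a \<le> p" "p < b" for a b using that by (auto, metis Suc_leI atLeastLessThan_iff disjoint_iff linorder_neqE_nat)
        have x3: "x b < x a" if "a \<in> {1..p}" "b \<in> {Suc p..n}" "S \<inter> {a..<p} = {}" "S \<inter> {Suc p..<b} = {}" for a b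
        proof (rule gt[of a b "S - {p}" S])
          have "p \<in> S \<inter> {a..<b}" using that p R by auto
          then show "S \<inter> {a..<b} \<noteq> {}" by blast
          show "(S - {p}) \<inter> {a..<b} = {}" using that by (subst Sp1) auto
        qed (use that pn in auto)
        \<comment> \<open>If \<open>S\<close> separates \<open>i\<close> from \<open>p\<close>, then
          \<open>x1\<close> leads from \<open>i\<close> to \<open>p\<close>; otherwise
          \<open>i\<close> itself is the left end in \<open>x3\<close>. The right end is treated
          likewise with \<open>x2\<close> and \<open>p + 1\<close>.\<close>
        consider "S \<inter> {i..<p} = {}" "S \<inter> {Suc p..<j} = {}" | "S \<inter> {i..<p} \<noteq> {}" "S \<inter> {Suc p..<j} = {}"
          | "S \<inter> {i..<p} = {}" "S \<inter> {Suc p..<j} \<noteq> {}" | "S \<inter> {i..<p} \<noteq> {}" "S \<inter> {Suc p..<j} \<noteq> {}" by blast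
        then show ?thesis
        proof cases
          case 1
          then show ?thesis using x3[of i j] ij pij by simp
        next
          case 2
          then show ?thesis using x3[of p j] x1 ij pij pn by simp
        next
          case 3
          then show ?thesis using x3[of i "Suc p"] x2 ij pij pn by simp
        next
          case 4
          then show ?thesis using x3[of p "Suc p"] x1 x2 pn by simp
        qed
      qed
      then show "q \<in> Inv n (blk n (R - {p}) x)"
        using ij unfolding Inv_blk[OF x Rp] by (auto simp: Inv_def)
    qed
  qed
  then have "blk n (R - {p}) x = blk n R x"
    by (rule Inv_inject[OF blk_Sym[OF x Rp] blk_Sym[OF x Rn]])
  then show ?thesis using e2 by simp
qed

text \<open>
  Conditions (i)-(iii) of the theorem for \<open>y\<close> and \<open>\<zeta>\<close> when \<open>D = Des \<zeta>\<close>, \<open>x = w \<circ> \<zeta>\<close> and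
  \<open>inv \<zeta> \<le> w\<close>, rewritten through the adjunction between \<open>par\<close> and \<open>blk\<close>.
\<close>

definition antipode_cond :: "nat \<Rightarrow> nat set \<Rightarrow> (nat \<Rightarrow> nat) \<Rightarrow> (nat \<Rightarrow> nat) \<Rightarrow> bool" where
  "antipode_cond n D x y \<longleftrightarrow> D \<subseteq> GDes n y \<and> weak_le n y (blk n (GDes n y) x) \<and>
     (\<forall>y'. weak_le n y y' \<and> weak_le n y' (blk n (GDes n y) x) \<longrightarrow> y' = y) \<and>
     (\<forall>R. D \<subseteq> R \<and> R \<subseteq> GDes n y \<and> weak_le n y (blk n R x) \<longrightarrow> R = GDes n y)"

text \<open>A nonempty fibre has \<open>GDes n y\<close> as its top. Under
  \<open>antipode_cond\<close> it is this one set and its sign remains; otherwise some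
  \<open>p\<close> can be removed from the top, and toggling \<open>p\<close> pairs off the fibre
  with opposite signs.\<close>

lemma sum_fibre:
  assumes x: "x \<in> Sym n" and D: "D \<subseteq> {1..<n}" and y: "y \<in> Sym n"
  shows "(\<Sum>R | D \<subseteq> R \<and> R \<subseteq> {1..<n} \<and> blk n R x = y. (-1 :: rat) ^ (card R + 1)) =
    (if antipode_cond n D x y then (-1) ^ (card (GDes n y) + 1) else 0)"
proof (cases "antipode_cond n D x y")
  case True
  let ?S = "GDes n y"
  have S: "?S \<subseteq> {1..<n}" by (auto simp: GDes_def)
  have c: "D \<subseteq> ?S" "weak_le n y (blk n ?S x)"
    "\<And>y'. weak_le n y y' \<Longrightarrow> weak_le n y' (blk n ?S x) \<Longrightarrow> y' = y"
    "\<And>R. D \<subseteq> R \<Longrightarrow> R \<subseteq> ?S \<Longrightarrow> weak_le n y (blk n R x) \<Longrightarrow> R = ?S"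
    using True unfolding antipode_cond_def by blast+
  \<comment> \<open>The maximality clause is applied to \<open>blk n ?S x\<close> itself, which lies
    above \<open>y\<close>.\<close>
  have "blk n ?S x = y" by (rule c(3)[OF c(2) weak_le_refl[OF blk_Sym[OF x S]]])
  moreover have "R = ?S" if "D \<subseteq> R" "R \<subseteq> {1..<n}" "blk n R x = y" for R
    using c(4)[OF that(1)] GDes_blk[OF x that(2)] that weak_le_refl[OF y] by simp
  ultimately have "{R. D \<subseteq> R \<and> R \<subseteq> {1..<n} \<and> blk n R x = y} = {?S}"
    using c(1) S by blast
  then show ?thesis using True by simp
next
  case False
  let ?S = "GDes n y" and ?F = "{R. D \<subseteq> R \<and> R \<subseteq> {1..<n} \<and> blk n R x = y}"
  have S: "?S \<subseteq> {1..<n}" by (auto simp: GDes_def)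
  show ?thesis
  proof (cases "?F = {}")
    case True
    show ?thesis unfolding True using False by simp
  next
    case ne: False
    then obtain R0 where R0: "D \<subseteq> R0" "R0 \<subseteq> {1..<n}" "blk n R0 x = y" by blast
    have sub: "R \<subseteq> ?S" if "R \<in> ?F" for R using GDes_blk[OF x, of R] that by auto
    have Sy: "blk n ?S x = y" using blk_GDes_blk[OF x R0(2)] R0(3) by simp
    have DS: "D \<subseteq> ?S" using R0 sub by blast
    \<comment> \<open>Since \<open>?S\<close> belongs to the fibre, all clauses of
      \<open>antipode_cond\<close> except the last hold automatically; its failure is therefore a
      failure of the last one.\<close>
    have "\<exists>R. D \<subseteq> R \<and> R \<subseteq> ?S \<and> weak_le n y (blk n R x) \<and> R \<noteq> ?S"
    proof (rule ccontr)
      assume "\<not> ?thesis"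
      then have "antipode_cond n D x y"
        unfolding antipode_cond_def Sy
        by (intro conjI DS weak_le_refl[OF y]) (auto dest: weak_le_antisym)
      with False show False by contradiction
    qed
    then obtain R where R: "D \<subseteq> R" "R \<subseteq> ?S" "weak_le n y (blk n R x)" "R \<noteq> ?S" by blast
    then obtain p where p: "p \<in> ?S" "p \<notin> R" by blast
    \<comment> \<open>The fibre is upward closed below \<open>?S\<close>: by monotonicity
      \<open>blk n Q x\<close> is squeezed between \<open>y\<close> and
      \<open>blk n ?S x = y\<close>.\<close>
    have sand: "blk n Q x = y" if "weak_le n y (blk n Q' x)" "Q' \<subseteq> Q" "Q \<subseteq> ?S" for Q Q'
    proof (rule weak_le_antisym)
      show "weak_le n (blk n Q x) y" using blk_mono[OF x that(3) S] Sy by simp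
      have "Q \<subseteq> {1..<n}" using that(3) S by blast
      then show "weak_le n y (blk n Q x)" using weak_le_trans[OF that(1) blk_mono[OF x that(2)]] by blast
    qed
    have Sp: "blk n (?S - {p}) x = y" by (rule sand[OF R(3)]) (use R p in auto)
    have "(\<Sum>R\<in>?F. (-1 :: rat) ^ (card R + 1)) = 0"
    proof (rule sum_involution_zero[of _ "\<lambda>R. if p \<in> R then R - {p} else insert p R"])
      fix Q assume Q: "Q \<in> ?F"
      have QS: "Q \<subseteq> ?S" by (rule sub[OF Q])
      have fin: "finite Q" by (rule finite_subset[OF subset_trans[OF QS S]]) simp
      show "(if p \<in> Q then Q - {p} else insert p Q) \<in> ?F"
      proof (cases "p \<in> Q")
        case True
        have "blk n Q x = blk n ?S x" "blk n (?S - {p}) x = blk n ?S x" using Q Sp Sy by simp_all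
        then have "blk n (Q - {p}) x = y" using blk_remove[OF x S QS True] Sy by simp
        moreover have "D \<subseteq> Q - {p}" "Q - {p} \<subseteq> {1..<n}" using Q R(1) p(2) by blast+
        ultimately show ?thesis using True by simp
      next
        case pQ: False
        have "blk n (insert p Q) x = y"
          by (rule sand[where Q' = Q]) (use Q QS p weak_le_refl[OF y] in auto)
        moreover have "D \<subseteq> insert p Q" "insert p Q \<subseteq> {1..<n}" using Q p S by blast+
        ultimately show ?thesis using pQ by simp
      qed
      show "(- 1 :: rat) ^ (card (if p \<in> Q then Q - {p} else insert p Q) + 1) = - ((- 1) ^ (card Q + 1))"
      proof (cases "p \<in> Q")
        case True
        have "card Q = Suc (card (Q - {p}))" by (rule card_Suc_Diff1[OF fin True, symmetric])
        then show ?thesis using True by simp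
      qed (use fin in simp)
    qed auto
    then show ?thesis using False by simp
  qed
qed

text \<open>The sets \<open>R\<close> are grouped by the value \<open>y\<close> of
  \<open>blk n R x\<close>, and each group is a complete fibre because \<open>y\<close> is already
  above \<open>v\<close>.\<close>

lemma sum_coarsenings:
  assumes x: "x \<in> Sym n" and D: "D \<subseteq> {1..<n}" and v: "v \<in> Sym n"
  shows "(\<Sum>R | D \<subseteq> R \<and> R \<subseteq> {1..<n} \<and> weak_le n v (blk n R x). (-1 :: rat) ^ (card R + 1)) =
    (\<Sum>y | weak_le n v y \<and> antipode_cond n D x y. (-1) ^ (card (GDes n y) + 1))"
proof -
  let ?A = "{R. D \<subseteq> R \<and> R \<subseteq> {1..<n} \<and> weak_le n v (blk n R x)}" and ?B = "{y. weak_le n v y}"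
  have "finite ?A" by (rule finite_subset[of _ "Pow {1..<n}"]) auto
  then have "(\<Sum>R\<in>?A. (-1 :: rat) ^ (card R + 1)) =
      (\<Sum>y\<in>?B. \<Sum>R | R \<in> ?A \<and> blk n R x = y. (-1) ^ (card R + 1))"
    by (intro sum.group[symmetric]) auto
  also have "\<dots> = (\<Sum>y\<in>?B. if antipode_cond n D x y then (-1) ^ (card (GDes n y) + 1) else 0)"
  proof (rule sum.cong[OF refl])
    fix y assume y: "y \<in> ?B"
    then have "{R. R \<in> ?A \<and> blk n R x = y} = {R. D \<subseteq> R \<and> R \<subseteq> {1..<n} \<and> blk n R x = y}" by auto
    then show "(\<Sum>R | R \<in> ?A \<and> blk n R x = y. (-1 :: rat) ^ (card R + 1)) = 
        (if antipode_cond n D x y then (-1) ^ (card (GDes n y) + 1) else 0)"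
      using sum_fibre[OF x D weak_le_Sym(2), of v y] y by simp
  qed
  also have "\<dots> = (\<Sum>y\<in>?B \<inter> {y. antipode_cond n D x y}. (-1) ^ (card (GDes n y) + 1))"
    by (simp only: sum.inter_restrict[OF finite_weak_ge] mem_Collect_eq)
  finally show ?thesis by (simp only: Collect_conj_eq)
qed

text \<open>As \<zeta> increases on the blocks of \<open>R\<close>, the inversions of
  \<open>par n R v \<circ> inv \<zeta>\<close> are those of \<open>inv \<zeta>\<close> together with
  the images under \<zeta> of the inversions of \<open>v\<close> inside a block. The former lie in
  \<open>Inv n w\<close> iff \<open>inv \<zeta>\<close> is below \<open>w\<close>; the latter,
  pulled back along \<zeta>, give the condition on \<open>v\<close>.\<close>

lemma weak_le_par_iff:
  assumes z: "\<zeta> \<in> Sym n" and w: "w \<in> Sym n" and v: "v \<in> Sym n"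
    and R: "Des n \<zeta> \<subseteq> R" "R \<subseteq> {1..<n}"
  shows "weak_le n (par n R v \<circ> inv \<zeta>) w \<longleftrightarrow>
    weak_le n (inv \<zeta>) w \<and> weak_le n v (blk n R (w \<circ> \<zeta>))"
proof -
  let ?x = "w \<circ> \<zeta>" and ?u = "par n R v \<circ> inv \<zeta>"
  have x: "?x \<in> Sym n" by (rule Sym_comp[OF w z])
  have iz: "inv \<zeta> \<in> Sym n" by (rule Sym_inv[OF z])
  note z' = Sym_inv_simps[OF z]
  have u: "?u \<in> Sym n" by (rule Sym_comp[OF par_Sym[OF R(2) v] iz])
  have r: "\<zeta> i \<in> {1..n} \<longleftrightarrow> i \<in> {1..n}" "inv \<zeta> i \<in> {1..n} \<longleftrightarrow> i \<in> {1..n}" for i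
    using Sym_in_range[OF z] Sym_in_range[OF iz] by blast+
  have lt: "\<zeta> i < \<zeta> j" if "i \<in> {1..n}" "j \<in> {1..n}" "i < j" "R \<inter> {i..<j} = {}" for i j
    by (rule Sym_Des_mono[OF z R(1) that])
  have par: "par n R v j < par n R v i \<longleftrightarrow> R \<inter> {i..<j} = {} \<and> v j < v i"
    if "i \<in> {1..n}" "j \<in> {1..n}" "i < j" for i j
    using par_less_iff[OF R(2) v that] Sym_less_cases[OF par_Sym[OF R(2) v], of i j]
      Sym_less_cases[OF v, of i j] that by auto
  have "Inv n ?u = Inv n (inv \<zeta>) \<union> {(\<zeta> i, \<zeta> j) | i j. (i, j) \<in> Inv n v \<and> R \<inter> {i..<j} = {}}"
    (is "_ = _ \<union> ?C")
  proof (intro equalityI subsetI)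
    fix q assume "q \<in> Inv n ?u"
    then obtain a b where q: "q = (a, b)" "a \<in> {1..n}" "b \<in> {1..n}" "a < b"
      and gt: "par n R v (inv \<zeta> b) < par n R v (inv \<zeta> a)" by (auto simp: Inv_def)
    have ij: "inv \<zeta> a \<in> {1..n}" "inv \<zeta> b \<in> {1..n}" using q r by blast+
    show "q \<in> Inv n (inv \<zeta>) \<union> ?C"
    proof (cases "inv \<zeta> b < inv \<zeta> a")
      case True
      then show ?thesis using q by (auto simp: Inv_def)
    next
      case False
      then have l: "inv \<zeta> a < inv \<zeta> b" using Sym_less_cases[OF iz, of a b] q by auto
      have "(inv \<zeta> a, inv \<zeta> b) \<in> Inv n v \<and> R \<inter> {inv \<zeta> a..<inv \<zeta> b} = {}"
        using gt par[OF ij l] ij l by (auto simp: Inv_def)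
      moreover have "q = (\<zeta> (inv \<zeta> a), \<zeta> (inv \<zeta> b))" using q z' by simp
      ultimately show ?thesis by blast
    qed
  next
    fix q assume "q \<in> Inv n (inv \<zeta>) \<union> ?C"
    then show "q \<in> Inv n ?u"
    proof
      assume "q \<in> Inv n (inv \<zeta>)"
      then obtain a b where q: "q = (a, b)" "a \<in> {1..n}" "b \<in> {1..n}" "a < b" "inv \<zeta> b < inv \<zeta> a"
        by (auto simp: Inv_def)
      have ij: "inv \<zeta> a \<in> {1..n}" "inv \<zeta> b \<in> {1..n}" using q r by blast+
      \<comment> \<open>Positions whose images \<zeta> puts in reverse order lie in different
        blocks, and \<open>par\<close> increases from one block to a later one.\<close>
      have "R \<inter> {inv \<zeta> b..<inv \<zeta> a} \<noteq> {}" using lt[OF ij(2,1) q(5)] q(4) z' by auto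
      then show ?thesis using q par_less_iff[OF R(2) v ij(2,1) q(5)] by (simp add: Inv_def)
    next
      assume "q \<in> ?C"
      then obtain i j where q: "q = (\<zeta> i, \<zeta> j)" and ij: "i \<in> {1..n}" "j \<in> {1..n}" "i < j"
        and e: "R \<inter> {i..<j} = {}" "v j < v i" by (auto simp: Inv_def)
      have "\<zeta> i \<in> {1..n}" "\<zeta> j \<in> {1..n}" using ij r by blast+
      then show ?thesis using lt[OF ij e(1)] par[OF ij] e unfolding q by (simp add: Inv_def z')
    qed
  qed
  then have "weak_le n ?u w \<longleftrightarrow> weak_le n (inv \<zeta>) w \<and> ?C \<subseteq> Inv n w"
    using u w iz by (simp add: weak_le_iff)
  also have "?C \<subseteq> Inv n w \<longleftrightarrow> Inv n v \<subseteq> Inv n (blk n R ?x)"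
  proof
    assume C: "?C \<subseteq> Inv n w"
    show "Inv n v \<subseteq> Inv n (blk n R ?x)"
    proof
      fix q assume q: "q \<in> Inv n v"
      then obtain i j where e: "q = (i, j)" and ij: "i \<in> {1..n}" "j \<in> {1..n}" "i < j" by (auto simp: Inv_def)
      have "(\<zeta> i, \<zeta> j) \<in> Inv n w" if "R \<inter> {i..<j} = {}" using C q that unfolding e by blast
      then show "q \<in> Inv n (blk n R ?x)" using ij unfolding e Inv_blk[OF x R(2)] by (auto simp: Inv_def)
    qed
  next
    assume C: "Inv n v \<subseteq> Inv n (blk n R ?x)"
    show "?C \<subseteq> Inv n w"
    proof
      fix q assume "q \<in> ?C"
      then obtain i j where q: "q = (\<zeta> i, \<zeta> j)" and ij: "(i, j) \<in> Inv n v" "R \<inter> {i..<j} = {}" by blast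
      have n: "i \<in> {1..n}" "j \<in> {1..n}" "i < j" using ij(1) by (auto simp: Inv_def)
      have "\<zeta> i \<in> {1..n}" "\<zeta> j \<in> {1..n}" using n r by blast+
      moreover have "(i, j) \<in> Inv n (blk n R ?x)" using C ij(1) by blast
      then have "w (\<zeta> j) < w (\<zeta> i)" using ij(2) unfolding Inv_blk[OF x R(2)] by (auto simp: Inv_def)
      ultimately show "q \<in> Inv n w" using lt[OF n ij(2)] unfolding q by (simp add: Inv_def)
    qed
  qed
  also have "\<dots> \<longleftrightarrow> weak_le n v (blk n R ?x)"
    using v blk_Sym[OF x R(2)] by (simp add: weak_le_iff)
  finally show ?thesis .
qed

text \<open>The three conditions are translated by \<open>weak_le_par_iff\<close>; membership in
  \<open>Sym_Des\<close> turns into the first clause of \<open>antipode_cond\<close>.\<close>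

lemma kappa_eq:
  assumes v: "v \<in> Sym n" and w: "w \<in> Sym n"
  shows "kappa n v w =
    card {\<zeta> \<in> Sym n. weak_le n (inv \<zeta>) w \<and> antipode_cond n (Des n \<zeta>) (w \<circ> \<zeta>) v}"
proof -
  let ?S = "GDes n v"
  have S: "?S \<subseteq> {1..<n}" by (auto simp: GDes_def)
  define P where "P \<zeta> \<longleftrightarrow> weak_le n (par n ?S v \<circ> inv \<zeta>) w \<and>
     (\<forall>v' \<in> Sym n. weak_le n v v' \<and> weak_le n (par n ?S v' \<circ> inv \<zeta>) w \<longrightarrow> v' = v) \<and>
     (\<forall>R. Des n \<zeta> \<subseteq> R \<and> R \<subseteq> ?S \<and> weak_le n (par n R v \<circ> inv \<zeta>) w \<longrightarrow> R = ?S)" for \<zeta>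
  have *: "P \<zeta> \<longleftrightarrow> weak_le n (inv \<zeta>) w \<and> antipode_cond n (Des n \<zeta>) (w \<circ> \<zeta>) v"
    if z: "\<zeta> \<in> Sym n" and D: "Des n \<zeta> \<subseteq> ?S" for \<zeta>
  proof -
    note * = weak_le_par_iff[OF z w]
    have 1: "weak_le n (par n ?S v' \<circ> inv \<zeta>) w \<longleftrightarrow>
        weak_le n (inv \<zeta>) w \<and> weak_le n v' (blk n ?S (w \<circ> \<zeta>))" if "v' \<in> Sym n" for v'
      by (rule *[OF that D S])
    have 2: "weak_le n (par n R v \<circ> inv \<zeta>) w \<longleftrightarrow>
        weak_le n (inv \<zeta>) w \<and> weak_le n v (blk n R (w \<circ> \<zeta>))" if "Des n \<zeta> \<subseteq> R" "R \<subseteq> ?S" for R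
      using *[OF v that(1)] that(2) S by blast
    \<comment> \<open>If \<open>inv \<zeta>\<close> is not below \<open>w\<close>, conditions (ii)
      and (iii) are vacuous, hence the premise here and in \<open>4\<close>. Condition (i) supplies
      it.\<close>
    have 3: "(\<forall>v' \<in> Sym n. weak_le n v v' \<and> weak_le n (par n ?S v' \<circ> inv \<zeta>) w \<longrightarrow> v' = v) \<longleftrightarrow>
        (weak_le n (inv \<zeta>) w \<longrightarrow> (\<forall>y. weak_le n v y \<and> weak_le n y (blk n ?S (w \<circ> \<zeta>)) \<longrightarrow> y = v))"
      using 1 weak_le_Sym(2)[of n v] by blast
    have 4: "(\<forall>R. Des n \<zeta> \<subseteq> R \<and> R \<subseteq> ?S \<and> weak_le n (par n R v \<circ> inv \<zeta>) w \<longrightarrow> R = ?S) \<longleftrightarrow>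
        (weak_le n (inv \<zeta>) w \<longrightarrow> (\<forall>R. Des n \<zeta> \<subseteq> R \<and> R \<subseteq> ?S \<and> weak_le n v (blk n R (w \<circ> \<zeta>)) \<longrightarrow> R = ?S))"
      using 2 by blast
    show ?thesis unfolding P_def antipode_cond_def 1[OF v] 3 4 using D by blast
  qed
  have "antipode_cond n (Des n \<zeta>) (w \<circ> \<zeta>) v \<Longrightarrow> Des n \<zeta> \<subseteq> ?S" for \<zeta>
    by (simp add: antipode_cond_def)
  with * have "{\<zeta> \<in> Sym_Des n ?S. P \<zeta>} =
     {\<zeta> \<in> Sym n. weak_le n (inv \<zeta>) w \<and> antipode_cond n (Des n \<zeta>) (w \<circ> \<zeta>) v}"
    unfolding Sym_Des_def by blast
  then show ?thesis by (simp only: kappa_def P_def)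
qed

section \<open>The algebra structure\<close>

lemma lin_ext_superset:
  assumes "finite A" "Poly_Mapping.keys x \<subseteq> A"
  shows "lin_ext f x = (\<Sum>a\<in>A. smult (Poly_Mapping.lookup x a) (f a))"
  unfolding lin_ext_def using assms by (intro sum.mono_neutral_left) (auto simp: in_keys_iff)

lemma lin_ext_add: "lin_ext f (x + y) = lin_ext f x + lin_ext f y"
proof -
  \<comment> \<open>Cancellation may shrink the support of the sum, so all three sums are taken over
    one common finite set.\<close>
  let ?A = "Poly_Mapping.keys x \<union> Poly_Mapping.keys y"
  have "Poly_Mapping.keys (x + y) \<subseteq> ?A" by (rule Poly_Mapping.keys_add)
  then show ?thesis
    by (simp add: lin_ext_superset[of ?A] lookup_add ssym.scale_left_distrib sum.distrib)
qed

lemma lin_ext_smult: "lin_ext f (smult c x) = smult c (lin_ext f x)"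
proof -
  have "Poly_Mapping.keys (smult c x) \<subseteq> Poly_Mapping.keys x" by (auto simp: in_keys_iff)
  then show ?thesis
    by (simp add: lin_ext_superset[of "Poly_Mapping.keys x"] ssym.scale_sum_right)
qed

lemma lin_ext_single [simp]: "lin_ext f (Poly_Mapping.single a 1) = f a"
  by (simp add: lin_ext_def)

lemma lin_ext_0 [simp]: "lin_ext f 0 = 0"
  by (simp add: lin_ext_def)

lemma lin_ext_sum: "lin_ext f (\<Sum>i\<in>I. x i) = (\<Sum>i\<in>I. lin_ext f (x i))"
  by (induction I rule: infinite_finite_induct) (simp_all add: lin_ext_add)

lemma lin_ext_comp: "lin_ext g (lin_ext f x) = lin_ext (\<lambda>a. lin_ext g (f a)) x"
  by (simp add: lin_ext_def[of f] lin_ext_sum lin_ext_smult) (simp add: lin_ext_def)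

lemma linear_smult_iff:
  "Vector_Spaces.linear smult smult S \<longleftrightarrow>
    (\<forall>x y. S (x + y) = S x + S y) \<and> (\<forall>c x. S (smult c x) = smult c (S x))"
  by (simp add: Vector_Spaces.linear_iff ssym.vector_space_axioms)

lemma linear_lin_ext: "Vector_Spaces.linear smult smult (lin_ext f)"
  by (simp add: linear_smult_iff lin_ext_add lin_ext_smult)

lemma lin_ext_id: "lin_ext (\<lambda>a. Poly_Mapping.single a 1) x = x"
proof (rule poly_mapping_eqI)
  fix b
  have "Poly_Mapping.lookup (lin_ext (\<lambda>a. Poly_Mapping.single a 1) x) b =
      (\<Sum>a\<in>Poly_Mapping.keys x. Poly_Mapping.lookup x a * (1 when a = b))"
    by (simp add: lin_ext_def lookup_sum lookup_single)
  also have "\<dots> = (\<Sum>a\<in>Poly_Mapping.keys x. if a = b then Poly_Mapping.lookup x a else 0)"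
    by (intro sum.cong) (auto simp: when_def)
  also have "\<dots> = Poly_Mapping.lookup x b" by (simp add: sum.delta in_keys_iff)
  finally show "Poly_Mapping.lookup (lin_ext (\<lambda>a. Poly_Mapping.single a 1) x) b = Poly_Mapping.lookup x b" .
qed

lemma linear_smult_sum:
  assumes S: "Vector_Spaces.linear smult smult S"
  shows "S (\<Sum>i\<in>I. x i) = (\<Sum>i\<in>I. S (x i))"
proof -
  have "S 0 = 0" using S by (metis linear_smult_iff ssym.scale_zero_left)
  then show ?thesis
    using S by (induction I rule: infinite_finite_induct) (simp_all add: linear_smult_iff)
qed

lemma linear_eq_lin_ext:
  assumes "Vector_Spaces.linear smult smult S"
  shows "S x = lin_ext (\<lambda>a. S (Poly_Mapping.single a 1)) x"
proof -
  have "S x = S (lin_ext (\<lambda>a. Poly_Mapping.single a 1) x)" by (simp only: lin_ext_id)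
  also have "\<dots> = lin_ext (\<lambda>a. S (Poly_Mapping.single a 1)) x"
    using assms by (simp add: lin_ext_def linear_smult_sum[OF assms]) (simp add: linear_smult_iff)
  finally show ?thesis .
qed

lemma fn_Sym: "fn a \<in> Sym (deg a)"
  using Rep_gperm[of a] by (auto simp: fn_def deg_def)

lemma F_basis_deg_fn: "F_basis (deg a) (fn a) = Poly_Mapping.single a 1"
  by (simp add: F_basis_def fn_def deg_def Rep_gperm_inverse)

lemma deg_fn_Abs:
  assumes "u \<in> Sym n"
  shows "deg (Abs_gperm (n, u)) = n" "fn (Abs_gperm (n, u)) = u"
  using assms by (simp_all add: deg_def fn_def Abs_gperm_inverse)

lemma lin_ext_F_basis: "u \<in> Sym n \<Longrightarrow> lin_ext (\<lambda>a. f (deg a) (fn a)) (F_basis n u) = f n u"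
  by (simp add: F_basis_def deg_fn_Abs)

lemma linear_eqI:
  assumes "Vector_Spaces.linear smult smult S" "Vector_Spaces.linear smult smult T"
    and "\<And>n u. u \<in> Sym n \<Longrightarrow> S (F_basis n u) = T (F_basis n u)"
  shows "S = T"
proof
  fix x
  have "S (Poly_Mapping.single a 1) = T (Poly_Mapping.single a 1)" for a
    using assms(3)[OF fn_Sym] by (simp only: F_basis_deg_fn)
  then show "S x = T x"
    by (simp add: linear_eq_lin_ext[OF assms(1), of x] linear_eq_lin_ext[OF assms(2), of x])
qed

section \<open>The product and convolution on basis elements\<close>

definition ssym_mult :: "ssym \<Rightarrow> ssym \<Rightarrow> ssym" where
  "ssym_mult x y = mult (tensor x y)"

lemma ssym_mult_eq:
  "ssym_mult x y = lin_ext (\<lambda>a. lin_ext (\<lambda>b. F_mult (deg a) (fn a) (deg b) (fn b)) y) x"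
  by (simp add: ssym_mult_def mult_def tensor_def lin_ext_comp)

lemma ssym_mult_linear_left: "Vector_Spaces.linear smult smult (\<lambda>x. ssym_mult x y)"
  unfolding ssym_mult_eq by (rule linear_lin_ext)

lemma ssym_mult_linear_right: "Vector_Spaces.linear smult smult (ssym_mult x)"
  by (simp add: linear_smult_iff ssym_mult_eq lin_ext_add lin_ext_smult)
    (simp add: lin_ext_def ssym.scale_right_distrib sum.distrib ssym.scale_sum_right ac_simps)

lemma ssym_mult_sum_left: "ssym_mult (\<Sum>i\<in>I. x i) y = (\<Sum>i\<in>I. ssym_mult (x i) y)"
  by (rule linear_smult_sum[OF ssym_mult_linear_left])

lemma ssym_mult_sum_right: "ssym_mult x (\<Sum>i\<in>I. y i) = (\<Sum>i\<in>I. ssym_mult x (y i))"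
  by (rule linear_smult_sum[OF ssym_mult_linear_right])

lemma ssym_mult_smult: "ssym_mult (smult c x) y = smult c (ssym_mult x y)" "ssym_mult x (smult c y) = smult c (ssym_mult x y)"
  using ssym_mult_linear_left[of y] ssym_mult_linear_right[of x] by (simp_all add: linear_smult_iff)

lemma ssym_mult_F_basis:
  assumes "u \<in> Sym p" "v \<in> Sym q"
  shows "ssym_mult (F_basis p u) (F_basis q v) = F_mult p u q v"
  using assms by (simp add: ssym_mult_eq F_basis_def deg_fn_Abs)

lemma convolution_linear: "Vector_Spaces.linear smult smult (convolution f g)"
  by (simp add: linear_smult_iff convolution_def mult_def tensor_map_def comult_def lin_ext_add lin_ext_smult)

lemma
  assumes "u \<in> Sym n" "p \<le> n"
  shows st_prefix_Sym: "st p u \<in> Sym p"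
    and st_prefix_less: "\<And>i j. i \<in> {1..p} \<Longrightarrow> j \<in> {1..p} \<Longrightarrow> st p u i < st p u j \<longleftrightarrow> u i < u j"
    and st_suffix_Sym: "st (n - p) (\<lambda>i. u (p + i)) \<in> Sym (n - p)"
    and st_suffix_less: "\<And>i j. i \<in> {1..n-p} \<Longrightarrow> j \<in> {1..n-p} \<Longrightarrow>
      st (n - p) (\<lambda>i. u (p + i)) i < st (n - p) (\<lambda>i. u (p + i)) j \<longleftrightarrow> u (p + i) < u (p + j)"
proof -
  have 1: "inj_on u {1..p}" by (rule Sym_inj_on[OF assms(1)])
  have "inj_on (u \<circ> (+) p) {1..n-p}"
    by (intro comp_inj_on Sym_inj_on[OF assms(1)]) simp
  then have 2: "inj_on (\<lambda>i. u (p + i)) {1..n-p}" by (simp add: comp_def)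
  show "st p u \<in> Sym p" "\<And>i j. i \<in> {1..p} \<Longrightarrow> j \<in> {1..p} \<Longrightarrow> st p u i < st p u j \<longleftrightarrow> u i < u j"
    "st (n - p) (\<lambda>i. u (p + i)) \<in> Sym (n - p)"
    "\<And>i j. i \<in> {1..n-p} \<Longrightarrow> j \<in> {1..n-p} \<Longrightarrow>
      st (n - p) (\<lambda>i. u (p + i)) i < st (n - p) (\<lambda>i. u (p + i)) j \<longleftrightarrow> u (p + i) < u (p + j)"
    using st_in_Sym[OF 1] st_less_iff[OF 1] st_in_Sym[OF 2] st_less_iff[OF 2] by blast+
qed

lemma convolution_F_basis:
  assumes "u \<in> Sym n"
  shows "convolution f g (F_basis n u) =
    (\<Sum>p=0..n. ssym_mult (f (F_basis p (st p u))) (g (F_basis (n - p) (st (n - p) (\<lambda>i. u (p + i))))))"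
proof -
  have "convolution f g (F_basis n u) = mult (tensor_map f g (F_comult n u))"
    using assms by (simp add: convolution_def comult_def lin_ext_F_basis)
  also have "\<dots> = (\<Sum>p=0..n. ssym_mult (f (F_basis p (st p u))) (g (F_basis (n - p) (st (n - p) (\<lambda>i. u (p + i))))))"
    by (simp add: F_comult_def tensor_map_def mult_def lin_ext_sum ssym_mult_def)
      (simp add: tensor_def F_basis_def)
  finally show ?thesis .
qed

text \<open>Without an admissible descent a permutation is increasing, hence the identity. The cuts
  0 and \<open>n\<close> arise in products with the unit.\<close>

lemma Sym_Des_trivial:
  assumes "R \<inter> {1..<n} = {}" shows "Sym_Des n R = {id}"
proof -
  have "\<zeta> = id" if "\<zeta> \<in> Sym_Des n R" for \<zeta>
  proof -
    have z: "\<zeta> \<in> Sym n" "Des n \<zeta> \<subseteq> R" using that by (auto simp: Sym_Des_def)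
    have "Des n \<zeta> \<subseteq> {}" using z assms by (auto simp: Des_def)
    then show ?thesis using strict_mono_permutes_id[of \<zeta> n] Sym_Des_mono[OF z(1), of "{}"] z(1) by blast
  qed
  moreover have "id \<in> Sym_Des n R" by (auto simp: Sym_Des_def Des_def permutes_id)
  ultimately show ?thesis by blast
qed

lemma st_0: "st 0 a = id"
  using st_in_Sym[of a 0] by simp

lemma st_self: "u \<in> Sym n \<Longrightarrow> st n u = u"
  by (rule st_eqI) (auto intro: Sym_inj_on)

lemma ssym_mult_one:
  assumes "u \<in> Sym n"
  shows "ssym_mult (F_basis n u) (F_basis 0 id) = F_basis n u" "ssym_mult (F_basis 0 id) (F_basis n u) = F_basis n u"
proof -
  have id0: "id \<in> Sym 0" by simp
  have "cross n u id = u"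
  proof
    fix i show "cross n u id i = u i"
      using assms permutes_not_in[of u "{1..n}" i] by (auto simp: cross_def)
  qed
  then show "ssym_mult (F_basis n u) (F_basis 0 id) = F_basis n u"
    using Sym_Des_trivial[of "{n}" n] by (simp add: ssym_mult_F_basis[OF assms id0] F_mult_def inv_id)
  have "cross 0 id u = u"
  proof
    fix i show "cross 0 id u i = u i"
      using assms permutes_not_in[of u "{1..n}" 0] by (auto simp: cross_def)
  qed
  then show "ssym_mult (F_basis 0 id) (F_basis n u) = F_basis n u"
    using Sym_Des_trivial[of "{0}" n] by (simp add: ssym_mult_F_basis[OF id0 assms] F_mult_def inv_id)
qed

section \<open>Concatenation of cut sets and the matching factorization of permutations\<close>

context
  fixes p q :: nat and R1 R2 R :: "nat set"
  assumes pq: "1 \<le> p" "1 \<le> q" and R1: "R1 \<subseteq> {1..<p}" and R2: "R2 \<subseteq> {1..<q}"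
    and R: "R = R1 \<union> {p} \<union> (+) p ` R2"
begin

lemma concat_subset: "R \<subseteq> {1..<p+q}"
  using R1 R2 R pq by auto

lemma concat_Int_low: "j \<le> p \<Longrightarrow> R \<inter> {i..<j} = R1 \<inter> {i..<j}"
  unfolding R by auto

lemma concat_Int_high: "p < i \<Longrightarrow> R \<inter> {i..<j} = {} \<longleftrightarrow> R2 \<inter> {i-p..<j-p} = {}"
  unfolding R using R1 by (auto simp: disjoint_iff)

text \<open>The first factor sees the cuts below \<open>p\<close>, the second those above
  \<open>p\<close>, shifted. A pair of positions separated by the cut \<open>p\<close> is increasing
  on both sides.\<close>

lemma par_cross:
  assumes v: "v \<in> Sym (p + q)"
  shows "cross p (par p R1 (st p v)) (par q R2 (st q (\<lambda>i. v (p + i)))) = par (p + q) R v"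
proof (rule Sym_eqI)
  have le: "p \<le> p + q" by simp
  note s1 = st_prefix_Sym[OF v le] st_prefix_less[OF v le]
  have s2: "st q (\<lambda>i. v (p + i)) \<in> Sym q" 
    "\<And>i j. i \<in> {1..q} \<Longrightarrow> j \<in> {1..q} \<Longrightarrow> st q (\<lambda>i. v (p + i)) i < st q (\<lambda>i. v (p + i)) j \<longleftrightarrow> v (p + i) < v (p + j)"
    using st_suffix_Sym[OF v le] st_suffix_less[OF v le] by simp_all
  note P1 = par_Sym[OF R1 s1(1)] par_less_iff[OF R1 s1(1)]
  note P2 = par_Sym[OF R2 s2(1)] par_less_iff[OF R2 s2(1)]
  show "cross p (par p R1 (st p v)) (par q R2 (st q (\<lambda>i. v (p + i)))) \<in> Sym (p + q)"
    by (rule cross_Sym[OF P1(1) P2(1)])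
  show "par (p + q) R v \<in> Sym (p + q)" by (rule par_Sym[OF concat_subset v])
  fix i j assume ij: "i \<in> {1..p+q}" "j \<in> {1..p+q}" "i < j"
  note * = cross_less_iff[OF P1(1) P2(1) ij] par_less_iff[OF concat_subset v ij]
  consider "j \<le> p" | "p < i" | "i \<le> p" "p < j" by linarith
  then show "cross p (par p R1 (st p v)) (par q R2 (st q (\<lambda>i. v (p + i)))) i
      < cross p (par p R1 (st p v)) (par q R2 (st q (\<lambda>i. v (p + i)))) j
      \<longleftrightarrow> par (p + q) R v i < par (p + q) R v j"
  proof cases
    case 1
    then show ?thesis unfolding * using ij P1(2)[of i j] s1(2)[of i j] concat_Int_low[OF 1] by simp
  next
    case 2
    then have e: "p + (i - p) = i" "p + (j - p) = j" using ij by auto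
    have l: "i - p \<in> {1..q}" "j - p \<in> {1..q}" "i - p < j - p" using 2 ij by auto
    show ?thesis unfolding * concat_Int_high[OF 2] using 2 ij P2(2)[OF l] s2(2)[OF l(1,2)] e by simp
  next
    case 3
    then have "p \<in> R \<inter> {i..<j}" using R by auto
    then show ?thesis unfolding * using 3 by auto
  qed
qed

text \<open>
  Factorization along the parabolic subgroup: \<open>\<zeta>\<close> is a minimal coset representative times the
  standardizations of its two halves.
\<close>

lemma sum_Sym_Des_split:
  "(\<Sum>(a, b, c)\<in>Sym_Des p R1 \<times> Sym_Des q R2 \<times> Sym_Des (p + q) {p}. f (c \<circ> cross p a b)) =
    (\<Sum>\<zeta>\<in>Sym_Des (p + q) R. f \<zeta>)"
proof -
  let ?s = "\<lambda>\<zeta>. st p \<zeta>" and ?t = "\<lambda>\<zeta>. st q (\<lambda>i. \<zeta> (p + i))"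
  let ?j = "\<lambda>(a, b, c). c \<circ> cross p a b"
  let ?i = "\<lambda>\<zeta>. (?s \<zeta>, ?t \<zeta>, \<zeta> \<circ> inv (cross p (?s \<zeta>) (?t \<zeta>)))"
  have le: "p \<le> p + q" by simp
  have A: "?i (c \<circ> cross p a b) = (a, b, c)" "c \<circ> cross p a b \<in> Sym_Des (p + q) R"
    if a: "a \<in> Sym_Des p R1" and b: "b \<in> Sym_Des q R2" and c: "c \<in> Sym_Des (p + q) {p}" for a b c
  proof -
    have a': "a \<in> Sym p" "Des p a \<subseteq> R1" using a by (auto simp: Sym_Des_def)
    have b': "b \<in> Sym q" "Des q b \<subseteq> R2" using b by (auto simp: Sym_Des_def)
    have c': "c \<in> Sym (p + q)" "Des (p + q) c \<subseteq> {p}" using c by (auto simp: Sym_Des_def)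
    let ?x = "cross p a b"
    have x: "?x \<in> Sym (p + q)" by (rule cross_Sym[OF a'(1) b'(1)])
    have cx: "c \<circ> ?x \<in> Sym (p + q)" by (rule Sym_comp[OF c'(1) x])
    have ra: "a i \<in> {1..p} \<longleftrightarrow> i \<in> {1..p}" and rb: "b i \<in> {1..q} \<longleftrightarrow> i \<in> {1..q}" for i
      using Sym_in_range a'(1) b'(1) by blast+
    \<comment> \<open>As \<open>c\<close> increases on each half, composing with it keeps the
      relative order of the values of \<open>a\<close> and of \<open>b\<close>; standardizing the
      halves then recovers \<open>a\<close> and \<open>b\<close>.\<close>
    have mono: "c k < c l" if "k \<in> {1..p+q}" "l \<in> {1..p+q}" "k < l" "l \<le> p \<or> p < k" for k l
      by (rule Sym_Des_mono[OF c' that(1-3)]) (use that(4) in auto)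
    have iff: "c k < c l \<longleftrightarrow> k < l" if "k \<in> {1..p+q}" "l \<in> {1..p+q}" "k \<le> p \<longleftrightarrow> l \<le> p" for k l
      using mono[of k l] mono[of l k] that by (cases k l rule: linorder_cases) auto
    have lo: "c (?x i) < c (?x j) \<longleftrightarrow> a i < a j" if "i \<in> {1..p}" "j \<in> {1..p}" for i j
      using iff[of "a i" "a j"] ra[of i] ra[of j] that by (simp add: cross_def)
    have hi: "c (?x (p + i)) < c (?x (p + j)) \<longleftrightarrow> b i < b j" if "i \<in> {1..q}" "j \<in> {1..q}" for i j
      using iff[of "b i + p" "b j + p"] rb[of i] rb[of j] that by (simp add: cross_def)
    have sa: "?s (c \<circ> ?x) = a"
      by (rule st_eqI[OF a'(1) Sym_inj_on[OF cx]]) (simp add: lo)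
    have "inj_on ((c \<circ> ?x) \<circ> (+) p) {1..q}"
      by (intro comp_inj_on[OF _ Sym_inj_on[OF cx]]) simp
    then have inj: "inj_on (\<lambda>i. (c \<circ> ?x) (p + i)) {1..q}" by (simp add: comp_def)
    have tb: "?t (c \<circ> ?x) = b"
      by (rule st_eqI[OF b'(1) inj]) (simp add: hi)
    have "c \<circ> ?x \<circ> inv ?x = c" using Sym_inv_simps[OF x] by (simp add: fun_eq_iff)
    then show "?i (c \<circ> ?x) = (a, b, c)" unfolding sa tb by simp
    have "Des (p + q) (c \<circ> ?x) \<subseteq> R"
    proof
      fix k assume k: "k \<in> Des (p + q) (c \<circ> ?x)"
      then have kr: "1 \<le> k" "k < p + q" and d: "\<not> c (?x k) < c (?x (k + 1))" by (auto simp: Des_def)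
      consider "k < p" | "k = p" | "p < k" by linarith
      then show "k \<in> R"
      proof cases
        case 1
        then have "\<not> a k < a (k + 1)" using d lo[of k "k + 1"] kr by simp
        then have "k \<in> Des p a" using 1 kr Sym_less_cases[OF a'(1), of k "k + 1"] by (auto simp: Des_def)
        then show ?thesis using a'(2) R by blast
      next
        case 2
        then show ?thesis using R by blast
      next
        case 3
        have e: "p + (k - p) = k" "p + (k - p + 1) = k + 1" using 3 by auto
        have "\<not> b (k - p) < b (k - p + 1)" using d hi[of "k - p" "k - p + 1"] kr 3 unfolding e by auto
        then have "k - p \<in> Des q b" using 3 kr Sym_less_cases[OF b'(1), of "k - p" "k - p + 1"]
          by (auto simp: Des_def)
        then have "p + (k - p) \<in> R" using b'(2) R by blast
        then show ?thesis using e by simp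
      qed
    qed
    then show "c \<circ> ?x \<in> Sym_Des (p + q) R" using cx by (simp add: Sym_Des_def)
  qed
  have B: "?j (?i \<zeta>) = \<zeta>" "?i \<zeta> \<in> Sym_Des p R1 \<times> Sym_Des q R2 \<times> Sym_Des (p + q) {p}"
    if "\<zeta> \<in> Sym_Des (p + q) R" for \<zeta>
  proof -
    have z: "\<zeta> \<in> Sym (p + q)" "Des (p + q) \<zeta> \<subseteq> R" using that by (auto simp: Sym_Des_def)
    note s1 = st_prefix_Sym[OF z(1) le] st_prefix_less[OF z(1) le]
    have s2: "?t \<zeta> \<in> Sym q" 
      "\<And>i j. i \<in> {1..q} \<Longrightarrow> j \<in> {1..q} \<Longrightarrow> ?t \<zeta> i < ?t \<zeta> j \<longleftrightarrow> \<zeta> (p + i) < \<zeta> (p + j)"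
      using st_suffix_Sym[OF z(1) le] st_suffix_less[OF z(1) le] by simp_all
    let ?x = "cross p (?s \<zeta>) (?t \<zeta>)"
    have x: "?x \<in> Sym (p + q)" by (rule cross_Sym[OF s1(1) s2(1)])
    show "?j (?i \<zeta>) = \<zeta>" using Sym_inv_simps[OF x] by (simp add: fun_eq_iff)
    have "Des p (?s \<zeta>) \<subseteq> R1"
    proof
      fix k assume k: "k \<in> Des p (?s \<zeta>)"
      then have kr: "1 \<le> k" "k < p" by (auto simp: Des_def)
      have "k \<in> Des (p + q) \<zeta>" using k kr s1(2)[of "k + 1" k] by (simp add: Des_def)
      then show "k \<in> R1" using z(2) kr R by auto
    qed
    moreover have "Des q (?t \<zeta>) \<subseteq> R2"
    proof
      fix k assume k: "k \<in> Des q (?t \<zeta>)"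
      then have kr: "1 \<le> k" "k < q" by (auto simp: Des_def)
      have "p + k \<in> Des (p + q) \<zeta>" using k kr s2(2)[of "k + 1" k] by (simp add: Des_def)
      then have "p + k \<in> R" using z(2) by blast
      moreover have "p + k \<notin> R1" using R1 by auto
      ultimately show "k \<in> R2" using kr unfolding R by auto
    qed
    \<comment> \<open>Undoing the two standardizations sorts the values of \<zeta> in each half, so
      a descent can remain only at \<open>p\<close>.\<close>
    moreover have "Des (p + q) (\<zeta> \<circ> inv ?x) \<subseteq> {p}"
    proof (rule subsetI, rule ccontr)
      fix k assume "k \<in> Des (p + q) (\<zeta> \<circ> inv ?x)" "k \<notin> {p}"
      then have kr: "1 \<le> k" "k < p + q" "k \<noteq> p" and d: "\<zeta> (inv ?x (k + 1)) < \<zeta> (inv ?x k)"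
        by (simp_all add: Des_def)
      have ix: "inv ?x = cross p (inv (?s \<zeta>)) (inv (?t \<zeta>))" by (rule inv_cross[OF s1(1) s2(1)])
      note d = d[unfolded ix]
      note i1 = Sym_inv_simps[OF s1(1)] and i2 = Sym_inv_simps[OF s2(1)]
      have r1: "inv (?s \<zeta>) i \<in> {1..p} \<longleftrightarrow> i \<in> {1..p}" and r2: "inv (?t \<zeta>) i \<in> {1..q} \<longleftrightarrow> i \<in> {1..q}" for i
        using Sym_in_range[OF Sym_inv[OF s1(1)]] Sym_in_range[OF Sym_inv[OF s2(1)]] by blast+
      show False
      proof (cases "k < p")
        case True
        then have m: "inv (?s \<zeta>) k \<in> {1..p}" "inv (?s \<zeta>) (k + 1) \<in> {1..p}"
          using r1[of k] r1[of "k + 1"] kr by simp_all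
        have "\<zeta> (inv (?s \<zeta>) (k + 1)) < \<zeta> (inv (?s \<zeta>) k)" using d True by (simp add: cross_def)
        then show False using s1(2)[OF m(2,1)] i1(1) by simp
      next
        case False
        then have k: "p < k" "k + 1 - p = k - p + 1" using kr by auto
        then have m: "inv (?t \<zeta>) (k - p) \<in> {1..q}" "inv (?t \<zeta>) (k - p + 1) \<in> {1..q}"
          using r2[of "k - p"] r2[of "k - p + 1"] kr by auto
        have "\<zeta> (p + inv (?t \<zeta>) (k - p + 1)) < \<zeta> (p + inv (?t \<zeta>) (k - p))"
          using d k by (simp add: cross_def add.commute)
        then show False using s2(2)[OF m(2,1)] i2(1) by simp
      qed
    qed
    moreover have "\<zeta> \<circ> inv ?x \<in> Sym (p + q)" by (intro Sym_comp Sym_inv z x)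
    ultimately show "?i \<zeta> \<in> Sym_Des p R1 \<times> Sym_Des q R2 \<times> Sym_Des (p + q) {p}"
      using s1(1) s2(1) by (simp add: Sym_Des_def)
  qed
  show ?thesis
  proof (rule sum.reindex_bij_witness[of _ ?i ?j])
    fix t assume "t \<in> Sym_Des p R1 \<times> Sym_Des q R2 \<times> Sym_Des (p + q) {p}"
    then obtain a b c where t: "t = (a, b, c)" "a \<in> Sym_Des p R1" "b \<in> Sym_Des q R2" "c \<in> Sym_Des (p + q) {p}"
      by blast
    show "?i (?j t) = t" unfolding t(1) prod.case by (rule A(1)[OF t(2-4)])
    show "?j t \<in> Sym_Des (p + q) R" unfolding t(1) prod.case by (rule A(2)[OF t(2-4)])
    show "f (?j t) = (case t of (a, b, c) \<Rightarrow> f (c \<circ> cross p a b))" unfolding t(1) prod.case ..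
  next
    fix z assume z: "z \<in> Sym_Des (p + q) R"
    show "?j (?i z) = z" by (rule B(1)[OF z])
    show "?i z \<in> Sym_Des p R1 \<times> Sym_Des q R2 \<times> Sym_Des (p + q) {p}" by (rule B(2)[OF z])
  qed
qed

end

text \<open>For \<open>R \<subseteq> {1..<n}\<close> this is the product of the fundamental elements
  of the blocks into which \<open>R\<close> cuts \<open>v\<close>, written as a single sum.\<close>

definition shuffles_of :: "nat \<Rightarrow> nat set \<Rightarrow> (nat \<Rightarrow> nat) \<Rightarrow> ssym" where
  "shuffles_of n R v = (\<Sum>\<zeta>\<in>Sym_Des n R. F_basis n (par n R v \<circ> inv \<zeta>))"

text \<open>The shuffles \<open>a\<close> and \<open>b\<close> inside the factors and the shuffle
  \<open>c\<close> from \<open>F_mult\<close> combine into one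
  \<open>\<zeta> = c \<circ> cross p a b\<close>, and each admissible \<zeta> arises exactly
  once.\<close>

lemma ssym_mult_shuffles_of:
  assumes pq: "1 \<le> p" "1 \<le> q" and R1: "R1 \<subseteq> {1..<p}" and R2: "R2 \<subseteq> {1..<q}"
    and v: "v \<in> Sym (p + q)"
  shows "ssym_mult (shuffles_of p R1 (st p v)) (shuffles_of q R2 (st q (\<lambda>i. v (p + i)))) =
    shuffles_of (p + q) (R1 \<union> {p} \<union> (+) p ` R2) v"
proof -
  let ?R = "R1 \<union> {p} \<union> (+) p ` R2"
  let ?u = "par p R1 (st p v)" and ?w = "par q R2 (st q (\<lambda>i. v (p + i)))"
  have le: "p \<le> p + q" by simp
  have u: "?u \<in> Sym p" by (rule par_Sym[OF R1 st_prefix_Sym[OF v le]])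
  have w: "?w \<in> Sym q" using par_Sym[OF R2, of "st q (\<lambda>i. v (p + i))"] st_suffix_Sym[OF v le] by simp
  have "ssym_mult (F_basis p (?u \<circ> inv a)) (F_basis q (?w \<circ> inv b)) =
     (\<Sum>c\<in>Sym_Des (p + q) {p}. F_basis (p + q) (par (p + q) ?R v \<circ> inv (c \<circ> cross p a b)))"
    if a: "a \<in> Sym_Des p R1" and b: "b \<in> Sym_Des q R2" for a b
  proof -
    have a': "a \<in> Sym p" using a by (auto simp: Sym_Des_def)
    have b': "b \<in> Sym q" using b by (auto simp: Sym_Des_def)
    have "cross p (?u \<circ> inv a) (?w \<circ> inv b) \<circ> inv c = par (p + q) ?R v \<circ> inv (c \<circ> cross p a b)"
      if "c \<in> Sym_Des (p + q) {p}" for c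
    proof -
      have c: "c \<in> Sym (p + q)" using that by (auto simp: Sym_Des_def)
      have "inv (c \<circ> cross p a b) = inv (cross p a b) \<circ> inv c"
        using c cross_Sym[OF a' b'] by (intro o_inv_distrib) (auto intro: permutes_bij)
      moreover have "cross p (?u \<circ> inv a) (?w \<circ> inv b) = par (p + q) ?R v \<circ> inv (cross p a b)"
        unfolding inv_cross[OF a' b'] par_cross[OF pq R1 R2 refl v, symmetric]
        by (rule cross_comp[OF Sym_inv[OF a'] Sym_inv[OF b'], symmetric])
      ultimately show ?thesis by (simp add: comp_assoc)
    qed
    then show ?thesis
      unfolding ssym_mult_F_basis[OF Sym_comp[OF u Sym_inv[OF a']] Sym_comp[OF w Sym_inv[OF b']]] F_mult_def
      by (intro sum.cong) simp_all
  qed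
  then have "ssym_mult (shuffles_of p R1 (st p v)) (shuffles_of q R2 (st q (\<lambda>i. v (p + i)))) =
    (\<Sum>a\<in>Sym_Des p R1. \<Sum>b\<in>Sym_Des q R2. \<Sum>c\<in>Sym_Des (p + q) {p}.
      F_basis (p + q) (par (p + q) ?R v \<circ> inv (c \<circ> cross p a b)))"
    unfolding shuffles_of_def ssym_mult_sum_left unfolding ssym_mult_sum_right by (intro sum.cong refl)
  also have "\<dots> = (\<Sum>(a, b, c)\<in>Sym_Des p R1 \<times> Sym_Des q R2 \<times> Sym_Des (p + q) {p}.
      F_basis (p + q) (par (p + q) ?R v \<circ> inv (c \<circ> cross p a b)))"
    by (simp add: sum.cartesian_product)
  also have "\<dots> = shuffles_of (p + q) ?R v"
    unfolding shuffles_of_def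
    by (rule sum_Sym_Des_split[OF pq R1 R2 refl, where f = "\<lambda>z. F_basis (p + q) (par (p + q) ?R v \<circ> inv z)"])
  finally show ?thesis .
qed

lemma shuffles_of_empty:
  assumes "v \<in> Sym n" shows "shuffles_of n {} v = F_basis n v"
proof -
  have "par n {} v = v"
    by (rule Sym_eqI[OF par_Sym assms]) (use assms par_less_iff[of "{}" n v] in auto)
  then show ?thesis by (simp add: shuffles_of_def Sym_Des_trivial inv_id)
qed

section \<open>The antipode on the fundamental basis\<close>

lemma sum_Pow_insert:
  fixes f :: "'b set \<Rightarrow> 'a :: comm_monoid_add"
  assumes "finite A" "a \<notin> A"
  shows "(\<Sum>R\<in>Pow (insert a A). f R) = (\<Sum>R\<in>Pow A. f R) + (\<Sum>R\<in>Pow A. f (insert a R))"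
proof -
  have "inj_on (insert a) (Pow A)"
    using assms(2) by (intro inj_onI) (metis Diff_insert_absorb PowD subsetD)
  moreover have "Pow A \<inter> insert a ` Pow A = {}" using assms(2) by auto
  ultimately show ?thesis using assms(1)
    unfolding Pow_insert by (subst sum.union_disjoint) (simp_all add: sum.reindex)
qed

text \<open>Nonempty sets are sorted by their largest element \<open>p\<close>, the cut that splits
  off the last block.\<close>

lemma sum_Pow_Max:
  fixes f :: "nat set \<Rightarrow> 'a :: comm_monoid_add"
  shows "(\<Sum>R\<in>Pow {1..<n}. f R) = f {} + (\<Sum>p\<in>{1..<n}. \<Sum>R\<in>Pow {1..<p}. f (insert p R))"
proof (induction n)
  case (Suc n)
  show ?case
  proof (cases "n = 0")
    case False
    then have e: "{1..<Suc n} = insert n {1..<n}" by auto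
    show ?thesis unfolding e by (simp add: sum_Pow_insert Suc.IH[simplified] ac_simps)
  qed simp
qed simp

text \<open>Nonempty sets are sorted by their least element \<open>p\<close>. The other cuts are
  shifted down by \<open>p\<close>, as the right-hand factor numbers its positions from 1.\<close>

lemma sum_Pow_Min:
  fixes f :: "nat set \<Rightarrow> 'a :: comm_monoid_add"
  shows "(\<Sum>R\<in>Pow {1..<n}. f R) =
    f {} + (\<Sum>p\<in>{1..<n}. \<Sum>R\<in>Pow {1..<n-p}. f (insert p ((+) p ` R)))"
proof (cases "n = 0")
  case False
  \<comment> \<open>The lower end varies so that the induction can split off the least
    element.\<close>
  have "(\<Sum>R\<in>Pow {k..<n}. f R) = f {} + (\<Sum>p\<in>{k..<n}. \<Sum>R\<in>Pow {Suc p..<n}. f (insert p R))"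
    if "k \<le> n" for k using that
  proof (induction k rule: inc_induct)
    case (step k)
    then have e: "{k..<n} = insert k {Suc k..<n}" by auto
    show ?case unfolding e by (simp add: sum_Pow_insert step.IH ac_simps)
  qed simp
  from this[of 1] False have 1: "(\<Sum>R\<in>Pow {1..<n}. f R) =
      f {} + (\<Sum>p\<in>{1..<n}. \<Sum>R\<in>Pow {Suc p..<n}. f (insert p R))" by simp
  have 2: "(\<Sum>R\<in>Pow {Suc p..<n}. f (insert p R)) = (\<Sum>R\<in>Pow {1..<n-p}. f (insert p ((+) p ` R)))"
    if "p \<in> {1..<n}" for p
  proof -
    have "(+) p ` {1..<n-p} = {Suc p..<n}" using that by simp
    then have "Pow {Suc p..<n} = (`) ((+) p) ` Pow {1..<n-p}" by (metis image_Pow_surj)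
    moreover have "inj_on ((`) ((+) p)) (Pow {1..<n-p})" by (intro inj_on_image_Pow) simp
    ultimately show ?thesis by (simp add: sum.reindex)
  qed
  show ?thesis unfolding 1 by (rule arg_cong[where f = "(+) (f {})"], rule sum.cong[OF refl 2])
qed simp

text \<open>Takeuchi's formula for the antipode of a graded connected Hopf algebra: \<open>k\<close>
  cuts give \<open>k + 1\<close> factors of positive degree, hence the exponent. In degree 0 there
  are no such factors and the sign is positive, whereas the sum would give a negative one.\<close>

definition takeuchi :: "nat \<Rightarrow> (nat \<Rightarrow> nat) \<Rightarrow> ssym" where
  "takeuchi n v = (if n = 0 then F_basis 0 v
    else \<Sum>R\<in>Pow {1..<n}. smult ((-1) ^ (card R + 1)) (shuffles_of n R v))"

lemma counit_F_basis: "u \<in> Sym n \<Longrightarrow> counit (F_basis n u) = (if n = 0 then 1 else 0)"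
proof (cases "n = 0")
  case False
  assume "u \<in> Sym n"
  then have "Abs_gperm (n, u) \<noteq> Abs_gperm (0, id)"
    using False deg_fn_Abs(1)[of u n] deg_fn_Abs(1)[of id 0] by auto
  then show ?thesis using False by (simp add: counit_def F_basis_def lookup_single)
qed (simp add: counit_def F_basis_def lookup_single)

lemma counit_linear: "Vector_Spaces.linear smult smult (\<lambda>x. smult (counit x) one_ssym)"
  by (simp add: linear_smult_iff counit_def lookup_add ssym.scale_left_distrib)

lemma sum_split_ends:
  fixes f :: "nat \<Rightarrow> 'a :: comm_monoid_add"
  assumes "n \<noteq> 0" shows "(\<Sum>p=0..n. f p) = f 0 + f n + (\<Sum>p\<in>{1..<n}. f p)"
proof -
  have "{0..n} = insert 0 (insert n {1..<n})" using assms by auto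
  then show ?thesis using assms by (simp add: ac_simps)
qed

text \<open>
  The summand for \<open>p\<close> consists of the terms of the Takeuchi sum with maximal (respectively minimal)
  element \<open>p\<close>, with the opposite sign.
\<close>

lemma takeuchi_convolution:
  assumes u: "u \<in> Sym n" and n: "n \<noteq> 0"
  shows "(\<Sum>p=0..n. ssym_mult (takeuchi p (st p u)) (F_basis (n - p) (st (n - p) (\<lambda>i. u (p + i))))) = 0" (is "?L = 0")
    and "(\<Sum>p=0..n. ssym_mult (F_basis p (st p u)) (takeuchi (n - p) (st (n - p) (\<lambda>i. u (p + i))))) = 0" (is "?R = 0")
proof -
  define g where "g R = smult ((-1) ^ (card R + 1)) (shuffles_of n R u)" for R
  have g0: "g {} = - F_basis n u" by (simp add: g_def shuffles_of_empty[OF u])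
  have Tn: "takeuchi n u = (\<Sum>R\<in>Pow {1..<n}. g R)" using n by (simp add: takeuchi_def g_def)
  have T0: "takeuchi 0 id = F_basis 0 id" by (simp add: takeuchi_def)
  have one: "ssym_mult (takeuchi n u) (F_basis 0 id) = takeuchi n u" "ssym_mult (F_basis 0 id) (takeuchi n u) = takeuchi n u"
  proof -
    have "ssym_mult (shuffles_of n R u) (F_basis 0 id) = shuffles_of n R u"
         "ssym_mult (F_basis 0 id) (shuffles_of n R u) = shuffles_of n R u" if "R \<subseteq> {1..<n}" for R
      unfolding shuffles_of_def ssym_mult_sum_left ssym_mult_sum_right
      using ssym_mult_one[OF Sym_comp[OF par_Sym[OF that u] Sym_inv]]
      by (auto intro!: sum.cong simp: Sym_Des_def)
    then show "ssym_mult (takeuchi n u) (F_basis 0 id) = takeuchi n u" "ssym_mult (F_basis 0 id) (takeuchi n u) = takeuchi n u"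
      unfolding Tn g_def ssym_mult_sum_left ssym_mult_sum_right ssym_mult_smult by (auto intro!: sum.cong)
  qed
  have neg: "smult ((-1) ^ (k + 1)) x = - smult ((-1) ^ (Suc k + 1)) x" for k and x :: ssym
    by simp
  have A: "ssym_mult (takeuchi p (st p u)) (F_basis (n - p) (st (n - p) (\<lambda>i. u (p + i)))) =
      - (\<Sum>R\<in>Pow {1..<p}. g (insert p R))" if p: "p \<in> {1..<n}" for p
  proof -
    have pn: "p \<le> n" "1 \<le> p" "1 \<le> n - p" "p + (n - p) = n" and nz: "p \<noteq> 0" "n - p \<noteq> 0"
      using p by auto
    let ?b = "st (n - p) (\<lambda>i. u (p + i))"
    \<comment> \<open>The uncut factor is the shuffle sum for the empty set, so the product rule for
      shuffle sums applies.\<close>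
    have b: "F_basis (n - p) ?b = shuffles_of (n - p) {} ?b"
      using shuffles_of_empty[OF st_suffix_Sym[OF u pn(1)]] by simp
    have "ssym_mult (takeuchi p (st p u)) (F_basis (n - p) ?b) =
       (\<Sum>R\<in>Pow {1..<p}. smult ((-1) ^ (card R + 1)) (ssym_mult (shuffles_of p R (st p u)) (shuffles_of (n - p) {} ?b)))"
      by (simp only: takeuchi_def nz if_False b ssym_mult_sum_left ssym_mult_smult)
    also have "\<dots> = (\<Sum>R\<in>Pow {1..<p}. - g (insert p R))"
    proof (rule sum.cong[OF refl])
      fix R assume "R \<in> Pow {1..<p}"
      then have R: "R \<subseteq> {1..<p}" and f: "finite R" "p \<notin> R" using finite_subset by auto
      have u': "u \<in> Sym (p + (n - p))" using u pn(4) by simp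
      have "ssym_mult (shuffles_of p R (st p u)) (shuffles_of (n - p) {} ?b) = shuffles_of n (insert p R) u"
        using ssym_mult_shuffles_of[OF pn(2,3) R _ u', of "{}"] pn(4) by simp
      then show "smult ((-1) ^ (card R + 1)) (ssym_mult (shuffles_of p R (st p u)) (shuffles_of (n - p) {} ?b)) = - g (insert p R)"
        unfolding g_def using f by simp
    qed
    finally show ?thesis by (simp add: sum_negf)
  qed
  have B: "ssym_mult (F_basis p (st p u)) (takeuchi (n - p) (st (n - p) (\<lambda>i. u (p + i)))) =
      - (\<Sum>R\<in>Pow {1..<n-p}. g (insert p ((+) p ` R)))" if p: "p \<in> {1..<n}" for p
  proof -
    have pn: "p \<le> n" "1 \<le> p" "1 \<le> n - p" "p + (n - p) = n" and nz: "p \<noteq> 0" "n - p \<noteq> 0"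
      using p by auto
    let ?b = "st (n - p) (\<lambda>i. u (p + i))"
    have b: "F_basis p (st p u) = shuffles_of p {} (st p u)"
      using shuffles_of_empty[OF st_prefix_Sym[OF u pn(1)]] by simp
    have "ssym_mult (F_basis p (st p u)) (takeuchi (n - p) ?b) =
       (\<Sum>R\<in>Pow {1..<n-p}. smult ((-1) ^ (card R + 1)) (ssym_mult (shuffles_of p {} (st p u)) (shuffles_of (n - p) R ?b)))"
      by (simp only: takeuchi_def nz if_False b ssym_mult_sum_right ssym_mult_smult)
    also have "\<dots> = (\<Sum>R\<in>Pow {1..<n-p}. - g (insert p ((+) p ` R)))"
    proof (rule sum.cong[OF refl])
      fix R assume "R \<in> Pow {1..<n-p}"
      then have R: "R \<subseteq> {1..<n-p}" and f: "finite ((+) p ` R)" "p \<notin> (+) p ` R" "card ((+) p ` R) = card R"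
        using finite_subset by (auto intro!: card_image)
      have u': "u \<in> Sym (p + (n - p))" using u pn(4) by simp
      have "ssym_mult (shuffles_of p {} (st p u)) (shuffles_of (n - p) R ?b) = shuffles_of n (insert p ((+) p ` R)) u"
        using ssym_mult_shuffles_of[OF pn(2,3) _ R u', of "{}"] pn(4) by simp
      then show "smult ((-1) ^ (card R + 1)) (ssym_mult (shuffles_of p {} (st p u)) (shuffles_of (n - p) R ?b)) =
          - g (insert p ((+) p ` R))"
        unfolding g_def using f by simp
    qed
    finally show ?thesis by (simp add: sum_negf)
  qed
  have [simp]: "st n u = u" "st n (\<lambda>i. u i) = u" using st_self[OF u] by simp_all
  \<comment> \<open>The end terms \<open>p = 0\<close> and \<open>p = n\<close> give
    \<open>F_basis n u\<close> and \<open>takeuchi n u\<close>. The empty cut set in the latter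
    cancels the former by \<open>g0\<close>, and the nonempty ones cancel the middle terms.\<close>
  have "?L = F_basis n u + takeuchi n u - (\<Sum>p\<in>{1..<n}. \<Sum>R\<in>Pow {1..<p}. g (insert p R))"
    unfolding sum_split_ends[OF n] using A by (simp add: st_0 T0 one ssym_mult_one[OF u] sum_negf)
  then show "?L = 0" unfolding Tn sum_Pow_Max[of g n] g0 by simp
  have "?R = takeuchi n u + F_basis n u - (\<Sum>p\<in>{1..<n}. \<Sum>R\<in>Pow {1..<n-p}. g (insert p ((+) p ` R)))"
    unfolding sum_split_ends[OF n] using B by (simp add: st_0 T0 one ssym_mult_one[OF u] sum_negf)
  then show "?R = 0" unfolding Tn sum_Pow_Min[of g n] g0 by simp
qed

lemma is_antipode_takeuchi: "is_antipode (lin_ext (\<lambda>a. takeuchi (deg a) (fn a)))"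
proof -
  let ?S = "lin_ext (\<lambda>a. takeuchi (deg a) (fn a))"
  have S: "?S (F_basis n u) = takeuchi n u" if "u \<in> Sym n" for n u
    by (rule lin_ext_F_basis[OF that])
  have id0: "id \<in> Sym 0" by simp
  have z: "ssym_mult (F_basis 0 id) (F_basis 0 id) = one_ssym"
    using ssym_mult_one[OF id0] by (simp add: one_ssym_def)
  have "convolution ?S id (F_basis n u) = smult (counit (F_basis n u)) one_ssym"
       "convolution id ?S (F_basis n u) = smult (counit (F_basis n u)) one_ssym" if u: "u \<in> Sym n" for n u
  proof -
    have c: "convolution ?S id (F_basis n u) =
        (\<Sum>p=0..n. ssym_mult (takeuchi p (st p u)) (F_basis (n - p) (st (n - p) (\<lambda>i. u (p + i)))))"
        "convolution id ?S (F_basis n u) =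
        (\<Sum>p=0..n. ssym_mult (F_basis p (st p u)) (takeuchi (n - p) (st (n - p) (\<lambda>i. u (p + i)))))"
    proof -
      have *: "?S (F_basis p (st p u)) = takeuchi p (st p u)"
        "?S (F_basis (n - p) (st (n - p) (\<lambda>i. u (p + i)))) = takeuchi (n - p) (st (n - p) (\<lambda>i. u (p + i)))"
        if "p \<in> {0..n}" for p
      proof -
        have "p \<le> n" using that by simp
        from S[OF st_prefix_Sym[OF u this]] S[OF st_suffix_Sym[OF u this]]
        show "?S (F_basis p (st p u)) = takeuchi p (st p u)"
          "?S (F_basis (n - p) (st (n - p) (\<lambda>i. u (p + i)))) = takeuchi (n - p) (st (n - p) (\<lambda>i. u (p + i)))" .
      qed
      show "convolution ?S id (F_basis n u) =
        (\<Sum>p=0..n. ssym_mult (takeuchi p (st p u)) (F_basis (n - p) (st (n - p) (\<lambda>i. u (p + i)))))"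
        "convolution id ?S (F_basis n u) =
        (\<Sum>p=0..n. ssym_mult (F_basis p (st p u)) (takeuchi (n - p) (st (n - p) (\<lambda>i. u (p + i)))))"
        unfolding convolution_F_basis[OF u] by (intro sum.cong refl; simp only: * id_apply)+
    qed
    have "convolution ?S id (F_basis n u) = smult (counit (F_basis n u)) one_ssym \<and>
      convolution id ?S (F_basis n u) = smult (counit (F_basis n u)) one_ssym"
    proof (cases "n = 0")
      case True
      have "takeuchi 0 a = F_basis 0 a" for a by (simp add: takeuchi_def)
      then show ?thesis unfolding c counit_F_basis[OF u] by (simp add: True st_0 z)
    next
      case False
      show ?thesis
        unfolding c counit_F_basis[OF u] takeuchi_convolution[OF u False] by (simp add: False)
    qed
    then show "convolution ?S id (F_basis n u) = smult (counit (F_basis n u)) one_ssym"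
      "convolution id ?S (F_basis n u) = smult (counit (F_basis n u)) one_ssym" by blast+
  qed
  note * = this
  have "convolution ?S id = (\<lambda>x. smult (counit x) one_ssym)"
    by (rule linear_eqI[OF convolution_linear counit_linear *(1)])
  moreover have "convolution id ?S = (\<lambda>x. smult (counit x) one_ssym)"
    by (rule linear_eqI[OF convolution_linear counit_linear *(2)])
  ultimately show ?thesis unfolding is_antipode_def using linear_lin_ext by blast
qed

text \<open>In the convolution with the identity, the term \<open>p = n\<close> is the value on
  \<open>F_basis n u\<close> itself, and all other terms involve values in smaller degree. This
  determines an antipode by recursion on the degree.\<close>

lemma is_antipode_unique:
  assumes "is_antipode S" "is_antipode T" shows "S = T"
proof (rule linear_eqI)
  show "Vector_Spaces.linear smult smult S" "Vector_Spaces.linear smult smult T"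
    using assms by (auto simp: is_antipode_def)
  \<comment> \<open>The unit law is extended by linearity, since the values of an antipode are
    arbitrary vectors.\<close>
  have one: "(\<lambda>x. ssym_mult x (F_basis 0 id)) = (\<lambda>x. x)"
    by (rule linear_eqI[OF ssym_mult_linear_left]) (simp_all add: linear_smult_iff ssym_mult_one)
  have rec: "U (F_basis n u) = smult (counit (F_basis n u)) one_ssym -
      (\<Sum>p\<in>{0..<n}. ssym_mult (U (F_basis p (st p u))) (F_basis (n - p) (st (n - p) (\<lambda>i. u (p + i)))))"
    if U: "is_antipode U" and u: "u \<in> Sym n" for U n u
  proof -
    have "convolution U id (F_basis n u) = smult (counit (F_basis n u)) one_ssym"
      using U by (simp add: is_antipode_def)
    moreover have "ssym_mult x (F_basis 0 id) = x" for x using fun_cong[OF one] .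
    ultimately show ?thesis unfolding convolution_F_basis[OF u] atLeast0AtMost atLeast0LessThan
      by (simp add: lessThan_Suc_atMost[symmetric] st_0 st_self[OF u] eq_diff_eq add.commute)
  qed
  show "S (F_basis n u) = T (F_basis n u)" if "u \<in> Sym n" for n u
    using that
  proof (induction n arbitrary: u rule: less_induct)
    case (less n)
    have "S (F_basis p (st p u)) = T (F_basis p (st p u))" if "p \<in> {0..<n}" for p
      using less.IH[of p "st p u"] st_prefix_Sym[OF less.prems, of p] that by simp
    then show ?case
      unfolding rec[OF assms(1) less.prems] rec[OF assms(2) less.prems] by simp
  qed
qed

lemma is_antipode_antipode: "is_antipode antipode"
  unfolding antipode_def
  by (rule theI[of is_antipode, OF is_antipode_takeuchi]) (rule is_antipode_unique[OF _ is_antipode_takeuchi])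

lemma antipode_F_basis:
  assumes "u \<in> Sym n" shows "antipode (F_basis n u) = takeuchi n u"
  using is_antipode_unique[OF is_antipode_antipode is_antipode_takeuchi] lin_ext_F_basis[OF assms, of takeuchi]
  by simp

lemma antipode_linear: "Vector_Spaces.linear smult smult antipode"
  using is_antipode_antipode by (simp add: is_antipode_def)

section \<open>Moebius inversion\<close>

lemma sum_mobius:
  assumes "weak_le n u y"
  shows "(\<Sum>z | weak_le n u z \<and> weak_le n z y. mobius n u z) = (if u = y then 1 else 0)"
proof (cases "u = y")
  case True
  then have "{z. weak_le n u z \<and> weak_le n z y} = {y}" using assms weak_le_antisym by blast
  then show ?thesis using True by (simp add: mobius.simps)
next
  case False
  let ?A = "{z. weak_le n u z \<and> weak_le n z y \<and> z \<noteq> y}"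
  have "{z. weak_le n u z \<and> weak_le n z y} = insert y ?A"
    using assms weak_le_refl[OF weak_le_Sym(2)[OF assms]] by blast
  moreover have "finite ?A" by (rule finite_subset[OF _ finite_weak_ge[of n u]]) auto
  moreover have "mobius n u y = - (\<Sum>z\<in>?A. mobius n u z)"
    using False assms by (subst mobius.simps) simp
  ultimately show ?thesis using False by simp
qed

text \<open>After exchanging the sums, \<open>K z\<close> is weighted by the sum of
  \<open>mobius n u\<close> over the interval from \<open>u\<close> to \<open>z\<close>. This serves
  both for the expansion of the fundamental basis and for the passage to the monomial basis at the
  end.\<close>

lemma mobius_inversion:
  fixes H K :: "(nat \<Rightarrow> nat) \<Rightarrow> ('a \<Rightarrow>\<^sub>0 rat)"
  assumes H: "\<And>u. u \<in> Sym n \<Longrightarrow> H u = (\<Sum>v | weak_le n u v. K v)" and u: "u \<in> Sym n"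
  shows "(\<Sum>v | weak_le n u v. smult (of_int (mobius n u v)) (H v)) = K u"
proof -
  let ?A = "{v. weak_le n u v}"
  have "(\<Sum>v\<in>?A. smult (of_int (mobius n u v)) (H v)) =
      (\<Sum>v\<in>?A. \<Sum>z | z \<in> ?A \<and> weak_le n v z. smult (of_int (mobius n u v)) (K z))"
  proof (rule sum.cong[OF refl])
    fix v assume v: "v \<in> ?A"
    then have "{z. z \<in> ?A \<and> weak_le n v z} = {z. weak_le n v z}" using weak_le_trans by blast
    then show "smult (of_int (mobius n u v)) (H v) =
        (\<Sum>z | z \<in> ?A \<and> weak_le n v z. smult (of_int (mobius n u v)) (K z))"
      using H[OF weak_le_Sym(2)[of n u v]] v by (simp add: ssym.scale_sum_right)
  qed
  also have "\<dots> = (\<Sum>z\<in>?A. \<Sum>v | v \<in> ?A \<and> weak_le n v z. smult (of_int (mobius n u v)) (K z))"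
    by (rule sum.swap_restrict) simp_all
  also have "\<dots> = (\<Sum>z\<in>?A. if u = z then K z else 0)"
  proof (rule sum.cong[OF refl])
    fix z assume z: "z \<in> ?A"
    have "(\<Sum>v | v \<in> ?A \<and> weak_le n v z. smult (of_int (mobius n u v)) (K z)) =
        smult (of_int (\<Sum>v | weak_le n u v \<and> weak_le n v z. mobius n u v)) (K z)"
      by (simp add: ssym.scale_sum_left)
    then show "(\<Sum>v | v \<in> ?A \<and> weak_le n v z. smult (of_int (mobius n u v)) (K z)) = (if u = z then K z else 0)"
      using z by (simp add: sum_mobius del: of_int_sum)
  qed
  also have "\<dots> = K u" using weak_le_refl[OF u] by (simp add: sum.delta)
  finally show ?thesis .
qed

text \<open>
  Solving \<open>H u = (\<Sum>v \<ge> u. K v)\<close> for \<open>K\<close> by recursion reduces the expansion of the fundamental basis to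
  the identity above, so that the dual recursion of the Moebius function is not needed.
\<close>

function weak_diff :: "((nat \<Rightarrow> nat) \<Rightarrow> ssym) \<Rightarrow> nat \<Rightarrow> (nat \<Rightarrow> nat) \<Rightarrow> ssym" where
  "weak_diff H n u = H u - (\<Sum>v | weak_le n u v \<and> v \<noteq> u. weak_diff H n v)"
  by pat_completeness auto
termination
proof (relation "measure (\<lambda>(H, n, u). card {v. weak_le n u v})")
  fix H :: "(nat \<Rightarrow> nat) \<Rightarrow> ssym" and n u v
  assume "v \<in> {v. weak_le n u v \<and> v \<noteq> u}"
  then have v: "weak_le n u v" "v \<noteq> u" by auto
  have "{z. weak_le n v z} \<subset> {z. weak_le n u z}"
  proof
    show "{z. weak_le n v z} \<subseteq> {z. weak_le n u z}" using v(1) weak_le_trans by blast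
    have "u \<in> {z. weak_le n u z}" "u \<notin> {z. weak_le n v z}"
      using weak_le_refl[OF weak_le_Sym(1)[OF v(1)]] v weak_le_antisym by blast+
    then show "{z. weak_le n v z} \<noteq> {z. weak_le n u z}" by blast
  qed
  then show "((H, n, v), (H, n, u)) \<in> measure (\<lambda>(H, n, u). card {v. weak_le n u v})"
    by (simp add: psubset_card_mono)
qed simp

declare weak_diff.simps [simp del]

text \<open>By construction the upward sums of \<open>weak_diff\<close> are the fundamental
  elements, and inversion identifies \<open>weak_diff\<close> with the monomial basis.\<close>

lemma F_basis_eq_sum_M_basis:
  assumes "u \<in> Sym n"
  shows "F_basis n u = (\<Sum>v | weak_le n u v. M_basis n v)"
proof -
  have F: "F_basis n u = (\<Sum>v | weak_le n u v. weak_diff (F_basis n) n v)" if "u \<in> Sym n" for u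
  proof -
    have "{v. weak_le n u v} = insert u {v. weak_le n u v \<and> v \<noteq> u}" using weak_le_refl[OF that] by blast
    moreover have "finite {v. weak_le n u v \<and> v \<noteq> u}"
      by (rule finite_subset[OF _ finite_weak_ge[of n u]]) auto
    ultimately show ?thesis by (simp add: weak_diff.simps[of _ n u])
  qed
  have "M_basis n v = weak_diff (F_basis n) n v" if "v \<in> Sym n" for v
    unfolding M_basis_def by (rule mobius_inversion[OF F that])
  then show ?thesis using F[OF assms] weak_le_Sym(2)[of n u] by (simp cong: sum.cong_simp)
qed

section \<open>The antipode on the monomial basis\<close>

text \<open>By \<open>weak_le_par_iff\<close> the condition that \<open>inv \<zeta>\<close> is below
  \<open>w\<close> is independent of \<open>R\<close> and comes out as a factor; what remains is
  \<open>sum_coarsenings\<close> for \<open>w \<circ> \<zeta>\<close>.\<close>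

lemma sum_coarsenings_shuffle:
  assumes z: "\<zeta> \<in> Sym n" and w: "w \<in> Sym n" and v: "v \<in> Sym n"
  shows "(\<Sum>R\<in>Pow {1..<n}. (-1) ^ (card R + 1) *
      of_bool (Des n \<zeta> \<subseteq> R \<and> weak_le n (par n R v \<circ> inv \<zeta>) w) :: rat) =
    (\<Sum>y | weak_le n v y. (-1) ^ (card (GDes n y) + 1) *
      of_bool (weak_le n (inv \<zeta>) w \<and> antipode_cond n (Des n \<zeta>) (w \<circ> \<zeta>) y))"
proof -
  let ?D = "Des n \<zeta>" and ?x = "w \<circ> \<zeta>" and ?b = "weak_le n (inv \<zeta>) w"
  have D: "?D \<subseteq> {1..<n}" by (auto simp: Des_def)
  have e: "Pow {1..<n} \<inter> {R. ?D \<subseteq> R \<and> weak_le n v (blk n R ?x)} =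
      {R. ?D \<subseteq> R \<and> R \<subseteq> {1..<n} \<and> weak_le n v (blk n R ?x)}" by auto
  have "(\<Sum>R\<in>Pow {1..<n}. (-1) ^ (card R + 1) *
      of_bool (?D \<subseteq> R \<and> weak_le n (par n R v \<circ> inv \<zeta>) w) :: rat) =
    (\<Sum>R\<in>Pow {1..<n}. of_bool ?b * (if R \<in> {R. ?D \<subseteq> R \<and> weak_le n v (blk n R ?x)} then (-1) ^ (card R + 1) else 0))"
    by (intro sum.cong refl) (auto simp: weak_le_par_iff[OF z w v])
  also have "\<dots> = of_bool ?b * (\<Sum>R | ?D \<subseteq> R \<and> R \<subseteq> {1..<n} \<and> weak_le n v (blk n R ?x). (-1) ^ (card R + 1))"
    by (simp only: sum_distrib_left[symmetric] sum.inter_restrict[symmetric] finite_Pow_iff finite_atLeastLessThan e)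
  also have "\<dots> = of_bool ?b * (\<Sum>y | weak_le n v y \<and> antipode_cond n ?D ?x y. (-1) ^ (card (GDes n y) + 1))"
    by (simp only: sum_coarsenings[OF Sym_comp[OF w z] D v])
  also have "\<dots> = of_bool ?b * (\<Sum>y\<in>{y. weak_le n v y}. if y \<in> {y. antipode_cond n ?D ?x y} then (-1) ^ (card (GDes n y) + 1) else 0)"
    by (simp only: sum.inter_restrict[OF finite_weak_ge, symmetric] Collect_conj_eq)
  also have "\<dots> = (\<Sum>y | weak_le n v y. (-1) ^ (card (GDes n y) + 1) * of_bool (?b \<and> antipode_cond n ?D ?x y))"
    unfolding sum_distrib_left by (intro sum.cong refl) simp
  finally show ?thesis .
qed

text \<open>The coefficient of \<open>M_basis n w\<close> in the Takeuchi sum is a signed count of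
  pairs of \<zeta> and \<open>R\<close>. Trading \<open>R\<close> for \<open>y\<close> above
  \<open>v\<close> and then counting the \<zeta> gives \<open>kappa n y w\<close>. The right side is
  an upward sum over \<open>y\<close>, as \<open>mobius_inversion\<close> requires.\<close>

lemma antipode_F_basis_M_basis:
  assumes n: "n \<ge> 1" and v: "v \<in> Sym n"
  shows "antipode (F_basis n v) = (\<Sum>y | weak_le n v y. smult ((-1) ^ (card (GDes n y) + 1))
    (\<Sum>w\<in>Sym n. smult (of_nat (kappa n y w)) (M_basis n w)))"
proof -
  let ?s = "\<lambda>R. (-1) ^ (card R + 1) :: rat"
  let ?c = "\<lambda>\<zeta> R w. of_bool (Des n \<zeta> \<subseteq> R \<and> weak_le n (par n R v \<circ> inv \<zeta>) w) :: rat"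
  have sh: "shuffles_of n R v = (\<Sum>\<zeta>\<in>Sym n. \<Sum>w\<in>Sym n. smult (?c \<zeta> R w) (M_basis n w))"
    if R: "R \<in> Pow {1..<n}" for R
  proof -
    have R': "R \<subseteq> {1..<n}" using R by blast
    have "shuffles_of n R v = (\<Sum>\<zeta>\<in>Sym n. if \<zeta> \<in> {\<zeta>. Des n \<zeta> \<subseteq> R} then F_basis n (par n R v \<circ> inv \<zeta>) else 0)"
      unfolding shuffles_of_def Sym_Des_def sum.inter_restrict[OF finite_Sym, symmetric]
      by (intro sum.cong) auto
    also have "\<dots> = (\<Sum>\<zeta>\<in>Sym n. \<Sum>w\<in>Sym n. smult (?c \<zeta> R w) (M_basis n w))"
    proof (rule sum.cong[OF refl])
      fix \<zeta> assume z: "\<zeta> \<in> Sym n"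
      let ?u = "par n R v \<circ> inv \<zeta>"
      have u: "?u \<in> Sym n" by (rule Sym_comp[OF par_Sym[OF R' v] Sym_inv[OF z]])
      have "F_basis n ?u = (\<Sum>w\<in>Sym n \<inter> {w. weak_le n ?u w}. M_basis n w)"
        unfolding F_basis_eq_sum_M_basis[OF u] using weak_le_Sym(2)[of n ?u] by (intro sum.cong) auto
      also have "\<dots> = (\<Sum>w\<in>Sym n. smult (of_bool (weak_le n ?u w)) (M_basis n w))"
        unfolding sum.inter_restrict[OF finite_Sym] by (intro sum.cong refl) simp
      finally have F: "F_basis n ?u = (\<Sum>w\<in>Sym n. smult (of_bool (weak_le n ?u w)) (M_basis n w))" .
      show "(if \<zeta> \<in> {\<zeta>. Des n \<zeta> \<subseteq> R} then F_basis n ?u else 0) = (\<Sum>w\<in>Sym n. smult (?c \<zeta> R w) (M_basis n w))"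
        unfolding F by (cases "Des n \<zeta> \<subseteq> R") simp_all
    qed
    finally show ?thesis .
  qed
  have "antipode (F_basis n v) = (\<Sum>R\<in>Pow {1..<n}. smult (?s R) (shuffles_of n R v))"
    using n by (simp add: antipode_F_basis[OF v] takeuchi_def)
  also have "\<dots> = (\<Sum>R\<in>Pow {1..<n}. \<Sum>\<zeta>\<in>Sym n. \<Sum>w\<in>Sym n. smult (?s R * ?c \<zeta> R w) (M_basis n w))"
    by (intro sum.cong refl) (simp only: sh ssym.scale_sum_right ssym.scale_scale)
  also have "\<dots> = (\<Sum>w\<in>Sym n. \<Sum>\<zeta>\<in>Sym n. \<Sum>R\<in>Pow {1..<n}. smult (?s R * ?c \<zeta> R w) (M_basis n w))"
    by (subst sum.swap, subst (2) sum.swap, subst sum.swap) (rule refl)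
  also have "\<dots> = (\<Sum>w\<in>Sym n. smult (\<Sum>\<zeta>\<in>Sym n. \<Sum>R\<in>Pow {1..<n}. ?s R * ?c \<zeta> R w) (M_basis n w))"
    by (simp only: ssym.scale_sum_left)
  also have "\<dots> = (\<Sum>w\<in>Sym n. smult (\<Sum>y | weak_le n v y. ?s (GDes n y) * of_nat (kappa n y w)) (M_basis n w))"
  proof (rule sum.cong[OF refl])
    fix w assume w: "w \<in> Sym n"
    let ?k = "\<lambda>\<zeta> y. weak_le n (inv \<zeta>) w \<and> antipode_cond n (Des n \<zeta>) (w \<circ> \<zeta>) y"
    have "(\<Sum>\<zeta>\<in>Sym n. \<Sum>R\<in>Pow {1..<n}. ?s R * ?c \<zeta> R w) =
        (\<Sum>\<zeta>\<in>Sym n. \<Sum>y | weak_le n v y. ?s (GDes n y) * of_bool (?k \<zeta> y))"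
      by (intro sum.cong refl sum_coarsenings_shuffle w v)
    also have "\<dots> = (\<Sum>y | weak_le n v y. ?s (GDes n y) * (\<Sum>\<zeta>\<in>Sym n. of_bool (?k \<zeta> y)))"
      by (subst sum.swap) (simp only: sum_distrib_left)
    also have "\<dots> = (\<Sum>y | weak_le n v y. ?s (GDes n y) * of_nat (kappa n y w))"
    proof (rule sum.cong[OF refl])
      fix y assume "y \<in> {y. weak_le n v y}"
      then have y: "y \<in> Sym n" using weak_le_Sym(2) by blast
      have "Sym n \<inter> {\<zeta>. ?k \<zeta> y} = {\<zeta> \<in> Sym n. ?k \<zeta> y}" by blast
      then have "(\<Sum>\<zeta>\<in>Sym n. of_bool (?k \<zeta> y)) = (of_nat (kappa n y w) :: rat)"
        unfolding kappa_eq[OF y w] by (subst sum_of_bool_eq[OF finite_Sym finite_Sym]) (simp only:)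
      then show "?s (GDes n y) * (\<Sum>\<zeta>\<in>Sym n. of_bool (?k \<zeta> y)) = ?s (GDes n y) * of_nat (kappa n y w)" by simp
    qed
    finally show "smult (\<Sum>\<zeta>\<in>Sym n. \<Sum>R\<in>Pow {1..<n}. ?s R * ?c \<zeta> R w) (M_basis n w) =
        smult (\<Sum>y | weak_le n v y. ?s (GDes n y) * of_nat (kappa n y w)) (M_basis n w)" by simp
  qed
  also have "\<dots> = (\<Sum>y | weak_le n v y. \<Sum>w\<in>Sym n. smult (?s (GDes n y) * of_nat (kappa n y w)) (M_basis n w))"
    unfolding ssym.scale_sum_left by (rule sum.swap)
  finally show ?thesis by (simp only: ssym.scale_sum_right ssym.scale_scale)
qed

theorem theorem2p4:
  fixes n :: nat and v :: "nat \<Rightarrow> nat"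
  assumes "n \<ge> 1" and "v \<in> Sym n"
  shows "antipode (M_basis n v) =
    smult ((-1) ^ (card (GDes n v) + 1)) (\<Sum>w \<in> Sym n. smult (of_nat (kappa n v w)) (M_basis n w))"
proof -
  have "antipode (smult c x) = smult c (antipode x)" for c x
    using antipode_linear by (simp add: linear_smult_iff)
  then have "antipode (M_basis n v) =
      (\<Sum>u | weak_le n v u. smult (of_int (mobius n v u)) (antipode (F_basis n u)))"
    by (simp only: M_basis_def linear_smult_sum[OF antipode_linear])
  \<comment> \<open>The values on the fundamental basis are upward sums, from which inversion
    extracts the single summand at \<open>v\<close>.\<close>
  also have "\<dots> = smult ((-1) ^ (card (GDes n v) + 1))
      (\<Sum>w \<in> Sym n. smult (of_nat (kappa n v w)) (M_basis n w))"
    by (rule mobius_inversion[OF antipode_F_basis_M_basis[OF assms(1)] assms(2)])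
  finally show ?thesis .
qed

end
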